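(* Let $0<\alpha,\beta\le1$ satisfy $\alpha+\beta>1$. If $f\in C^\alpha([0,1])$ and $g\in C^\beta([0,1])$, then there exist exponents $p,q>1$ with $\frac1p+\frac1q=1$ such that $f\in\mathcal E^p$ and $g\in\mathcal E^q$. Consequently, the Faber--Schauder integrals $I_{f,g}$ and $I_{g,f}$ exist on $[0,1]$ and agree with the classical Young integrals: $$I_{f,g}(t)=\int_0^t f\,d^Yg,\qquad I_{g,f}(t)=\int_0^t g\,d^Yf,\qquad t\in[0,1].$$ Moreover, the integration-by-parts identity $$\int_s^t f\,dg+\int_s^t g\,df=f(t)g(t)-f(s)g(s),\qquad s,t\in[0,1],$$ holds, and the dyadic Young--Lo\`eve estimate applies: for every $0\le s\le\xi\le t\le1$ and every integer $N\ge0$ with $t-s\le2^{-N}$, $$\bigg|\int_s^t f\,dg-f(\xi)\big(g(t)-g(s)\big)\bigg|\le 8L_f^{(p)}(N)L_g^{(q)}(N).$$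
   Context: $C([0,1])$ denotes the real-valued continuous functions on $[0,1]$, $\|\cdot\|_\infty$ the uniform norm. $C^\alpha([0,1])$ ($0<\alpha\le1$) is the space of $\alpha$-H\"older continuous real functions on $[0,1]$. $\int_0^t f\,d^Yg$ denotes the classical Young integral, i.e. the limit of Riemann--Stieltjes sums $\sum_i f(\xi_i)(g(s_{i+1})-g(s_i))$, $\xi_i\in[s_i,s_{i+1}]$, over partitions of $[0,t]$ with mesh tending to zero. $\mathbb N_0=\{0,1,2,\dots\}$, $\mathbb N_{-1}=\{-1,0,1,\dots\}$. For $n\in\mathbb N_0$: $t_{n,k}=k2^{-n}$ for $0\le k\le 2^n$, $\mathbb T_n=\{t_{n,k}:0\le k\le 2^n\}$, $\mathbb T=\bigcup_{n\ge0}\mathbb T_n$, $I_n=\{0,\dots,2^n-1\}$; for $t\in\mathbb T$, $\ell(t)=\min\{m\ge0:t\in\mathbb T_m\}$. Dyadic left sums: for $f,g\in C([0,1])$, $t\in\mathbb T$, $n\ge\ell(t)$, $$S_n^L(t;f,g)=\sum_{k=0}^{2^nt-1}f(t_{n,k})\big(g(t_{n,k+1})-g(t_{n,k})\big)$$ (empty sum $=0$). The dyadic integral over $[0,t]$ exists if $(S_n^L(t;f,g))_{n\ge\ell(t)}$ converges, and its limit is denoted $I^{\mathbb T}_{f,g}(t)$. Faber--Schauder integral: if $I^{\mathbb T}_{f,g}(t)$ exists for every $t\in\mathbb T$ and the map $I^{\mathbb T}_{f,g}:\mathbb T\to\mathbb R$ admits a (necessarily unique) continuous extension to $[0,1]$,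 this extension is denoted $I_{f,g}:[0,1]\to\mathbb R$ and one says that the Faber--Schauder integral $I_{f,g}$ exists on $[0,1]$. In that case $\int_s^t f\,dg:=I_{f,g}(t)-I_{f,g}(s)$ for all $s,t\in[0,1]$. Faber--Schauder coefficients of $f\in C([0,1])$: $\theta^f_{-1,0}=f(1)-f(0)$, and for $n\ge0$, $k\in I_n$, $\theta^f_{n,k}=2^{n/2}\big(2f(t_{n+1,2k+1})-f(t_{n,k})-f(t_{n,k+1})\big)$. Level energies ($p>1$): $\zeta_f^{(p)}(-1)=2^{1-\frac1p}|\theta^f_{-1,0}|$ and $\zeta_f^{(p)}(n)=\big(2^{-np/2}\sum_{k\in I_n}|\theta^f_{n,k}|^p\big)^{1/p}$ for $n\ge0$. Schauder tail sequence: $H_f(n)=\sum_{m=n}^\infty 2^{-m/2}\sup_{k\in I_m}|\theta^f_{m,k}|\in[0,\infty]$ for $n\ge0$. Energy space ($p>1$): $\|f\|_{\mathcal E^p}=\|f\|_\infty+\|\zeta_f^{(p)}\|_{\ell^p(\mathbb N_{-1})}+\|H_f\|_{\ell^p(\mathbb N_0)}$ and $\mathcal E^p=\{f\in C([0,1]):\|f\|_{\mathcal E^p}<\infty\}$. For $r>1$ and $h\in\mathcal E^r$: $\mathcal A_h^{(r)}(n)=\sum_{m=-1}^n 2^{-(n-m)(1-\frac1r)}\zeta_h^{(r)}(m)$ for $n\ge0$, and $$L_h^{(r)}(N)=\|\mathcal A_h^{(r)}\|_{\ell^r_{\ge N}}+\tfrac12\|H_h\|_{\ell^r_{\ge N}},\qquad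 \|a\|_{\ell^r_{\ge N}}:=\Big(\sum_{n=N}^\infty|a_n|^r\Big)^{1/r},\qquad N\ge0.$$ *)

theory Defs
  imports "HOL-Analysis.Analysis"
begin

text \<open>
  Functions on the unit interval are represented by functions of type
  \<^typ>\<open>real \<Rightarrow> real\<close>; only their values on \<^term>\<open>{0..1::real}\<close> enter the notions below.
\<close>

subsection \<open>Hoelder spaces and the Young integral\<close>

definition hoelder_space :: "real \<Rightarrow> (real \<Rightarrow> real) set" where
  "hoelder_space \<alpha> =
     {f. \<exists>C. \<forall>x\<in>{0..1}. \<forall>y\<in>{0..1}. \<bar>f x - f y\<bar> \<le> C * \<bar>x - y\<bar> powr \<alpha>}"

text \<open>
  \<open>I\<close> is the limit of the Riemann--Stieltjes sums over tagged partitions of \<open>[a,b]\<close> as the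
  mesh tends to zero. A partition is strictly increasing, so for \<open>a = b\<close> only the trivial
  partition (\<open>n = 0\<close>, empty sum) remains.
\<close>

definition has_young_integral ::
    "(real \<Rightarrow> real) \<Rightarrow> (real \<Rightarrow> real) \<Rightarrow> real \<Rightarrow> real \<Rightarrow> real \<Rightarrow> bool" where
  "has_young_integral f g a b I \<longleftrightarrow>
     (\<forall>\<epsilon>>0. \<exists>\<delta>>0. \<forall>(n::nat) s \<xi>.
        s 0 = a \<and> s n = b \<and>
        (\<forall>i<n. s i < s (Suc i) \<and> s (Suc i) - s i < \<delta> \<and> \<xi> i \<in> {s i..s (Suc i)})
        \<longrightarrow> \<bar>(\<Sum>i<n. f (\<xi> i) * (g (s (Suc i)) - g (s i))) - I\<bar> < \<epsilon>)"


subsection \<open>Dyadic left sums and the Faber--Schauder integral\<close>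

definition dyadic_pt :: "nat \<Rightarrow> nat \<Rightarrow> real" where
  "dyadic_pt n k = real k / 2 ^ n"

definition dyadic_grid :: "nat \<Rightarrow> real set" where
  "dyadic_grid n = dyadic_pt n ` {0..2 ^ n}"

definition dyadics :: "real set" where
  "dyadics = (\<Union>n. dyadic_grid n)"

definition dyadic_level :: "real \<Rightarrow> nat" where
  "dyadic_level t = (LEAST m. t \<in> dyadic_grid m)"

text \<open>The floor is exact whenever \<open>t \<in> dyadic_grid n\<close>, where \<open>2 ^ n * t\<close> is a natural number.\<close>

definition left_sum :: "(real \<Rightarrow> real) \<Rightarrow> (real \<Rightarrow> real) \<Rightarrow> real \<Rightarrow> nat \<Rightarrow> real" where
  "left_sum f g t n =
     (\<Sum>k<nat \<lfloor>2 ^ n * t\<rfloor>. f (dyadic_pt n k) * (g (dyadic_pt n (k + 1)) - g (dyadic_pt n k)))"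

definition dyadic_integrable :: "(real \<Rightarrow> real) \<Rightarrow> (real \<Rightarrow> real) \<Rightarrow> real \<Rightarrow> bool" where
  "dyadic_integrable f g t \<longleftrightarrow> convergent (\<lambda>j. left_sum f g t (dyadic_level t + j))"

definition dyadic_integral :: "(real \<Rightarrow> real) \<Rightarrow> (real \<Rightarrow> real) \<Rightarrow> real \<Rightarrow> real" where
  "dyadic_integral f g t = lim (\<lambda>j. left_sum f g t (dyadic_level t + j))"

definition fs_extension :: "(real \<Rightarrow> real) \<Rightarrow> (real \<Rightarrow> real) \<Rightarrow> (real \<Rightarrow> real) \<Rightarrow> bool" where
  "fs_extension f g F \<longleftrightarrow>
     continuous_on {0..1} F \<and> (\<forall>t\<in>dyadics. F t = dyadic_integral f g t)"

definition fs_integrable :: "(real \<Rightarrow> real) \<Rightarrow> (real \<Rightarrow> real) \<Rightarrow> bool" where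
  "fs_integrable f g \<longleftrightarrow> (\<forall>t\<in>dyadics. dyadic_integrable f g t) \<and> (\<exists>F. fs_extension f g F)"

text \<open>
  The dyadic points are dense in \<open>[0,1]\<close>, so the choice is irrelevant on \<open>[0,1]\<close>; values
  outside \<open>[0,1]\<close> are unspecified.
\<close>

definition fs_integral :: "(real \<Rightarrow> real) \<Rightarrow> (real \<Rightarrow> real) \<Rightarrow> real \<Rightarrow> real" where
  "fs_integral f g = (SOME F. fs_extension f g F)"

definition fs_integral_between ::
    "(real \<Rightarrow> real) \<Rightarrow> (real \<Rightarrow> real) \<Rightarrow> real \<Rightarrow> real \<Rightarrow> real" where
  "fs_integral_between f g s t = fs_integral f g t - fs_integral f g s"


subsection \<open>Schauder coefficients and energy spaces\<close>

text \<open>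
  Levels are integers so that the coefficient of the linear part can sit at level \<open>-1\<close>
  (with index \<open>k = 0\<close>); levels below \<open>-1\<close> are never used.
\<close>

definition schauder_coeff :: "(real \<Rightarrow> real) \<Rightarrow> int \<Rightarrow> nat \<Rightarrow> real" where
  "schauder_coeff f n k =
     (if n = -1 then f 1 - f 0
      else 2 powr (of_int n / 2) *
        (2 * f (dyadic_pt (nat n + 1) (2 * k + 1))
           - f (dyadic_pt (nat n) k) - f (dyadic_pt (nat n) (k + 1))))"

definition level_energy :: "real \<Rightarrow> (real \<Rightarrow> real) \<Rightarrow> int \<Rightarrow> real" where
  "level_energy p f n =
     (if n = -1 then 2 powr (1 - 1 / p) * \<bar>schauder_coeff f (-1) 0\<bar>
      else (2 powr (- (of_int n * p / 2)) *
              (\<Sum>k<2 ^ nat n. \<bar>schauder_coeff f n k\<bar> powr p)) powr (1 / p))"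

definition schauder_tail :: "(real \<Rightarrow> real) \<Rightarrow> nat \<Rightarrow> ennreal" where
  "schauder_tail f n =
     (\<Sum>j. ennreal (2 powr (- (real (n + j) / 2)) *
              (SUP k\<in>{..<2 ^ (n + j)}. \<bar>schauder_coeff f (int (n + j)) k\<bar>)))"

text \<open>Real powers on \<open>[0,\<infinity>]\<close>, meant for exponents \<open>r > 0\<close>.\<close>

definition ennreal_powr :: "ennreal \<Rightarrow> real \<Rightarrow> ennreal" where
  "ennreal_powr x r = (if x = \<infinity> then \<infinity> else ennreal (enn2real x powr r))"

definition lp_norm :: "real \<Rightarrow> 'i set \<Rightarrow> ('i \<Rightarrow> ennreal) \<Rightarrow> ennreal" where
  "lp_norm p A a = ennreal_powr (\<Sum>\<^sub>\<infinity>i\<in>A. ennreal_powr (a i) p) (1 / p)"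

definition energy_norm :: "real \<Rightarrow> (real \<Rightarrow> real) \<Rightarrow> ennreal" where
  "energy_norm p f =
     (SUP t\<in>{0..1}. ennreal \<bar>f t\<bar>)
       + lp_norm p {-1..} (\<lambda>n. ennreal (level_energy p f n))
       + lp_norm p UNIV (schauder_tail f)"

definition energy_space :: "real \<Rightarrow> (real \<Rightarrow> real) set" where
  "energy_space p = {f. continuous_on {0..1} f \<and> energy_norm p f < \<infinity>}"

definition accumulated_energy :: "real \<Rightarrow> (real \<Rightarrow> real) \<Rightarrow> nat \<Rightarrow> real" where
  "accumulated_energy r h n =
     (\<Sum>m\<in>{-1..int n}. 2 powr (- (of_int (int n - m) * (1 - 1 / r))) * level_energy r h m)"

definition local_energy :: "real \<Rightarrow> (real \<Rightarrow> real) \<Rightarrow> nat \<Rightarrow> ennreal" where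
  "local_energy r h N =
     lp_norm r {N..} (\<lambda>n. ennreal (accumulated_energy r h n))
       + ennreal (1 / 2) * lp_norm r {N..} (schauder_tail h)"

end

theory Submission
  imports Defs
begin

text \<open>
  Write \<open>\<zeta>\<close>, \<open>A\<close> and \<open>H\<close> for the level energies, the accumulated energies and the Schauder tail.

  Halving a dyadic interval turns the increment \<open>d\<close> of \<open>f\<close> over it into \<open>(d + e) / 2\<close> and
  \<open>(d - e) / 2\<close>, where \<open>e\<close> is the rescaled Schauder coefficient. By Minkowski's inequality the
  \<open>\<ell>\<^sup>p\<close> norm \<open>v n\<close> of the increments at level \<open>n\<close> satisfies
  \<open>v (n + 1) \<le> 2 powr (- (1 - 1 / p)) * (v n + \<zeta> n)\<close>. This is the recursion that defines \<open>A\<close>, so both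
  \<open>v n\<close> and \<open>v (n + 1)\<close> are at most \<open>A n\<close> (\<open>dyadic_variation_le\<close>). The piecewise linear
  interpolation of \<open>f\<close> on level \<open>n\<close> differs from \<open>f\<close> by at most \<open>H n / 2\<close>
  (\<open>dyadic_interp_error\<close>). Hence \<open>A\<close> and \<open>H\<close> control all increments of \<open>f\<close> at scale \<open>2\<^sup>-\<^sup>n\<close>.

  The left sums make sense for every real endpoint \<open>x\<close>, with the grid point \<open>x\<^sub>n\<close> just below \<open>x\<close>
  as actual endpoint. Refining by one level adds, for every interval, the increment of \<open>f\<close> over its
  left half times the increment of \<open>g\<close> over its right half, and one boundary term
  \<open>f x\<^sub>n * (g x\<^sub>n\<^sub>+\<^sub>1 - g x\<^sub>n)\<close> (\<open>left_sum_refine\<close>). The boundary terms alone need not be summable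
  over the levels, but after subtracting \<open>f x * (g x\<^sub>n\<^sub>+\<^sub>1 - g x\<^sub>n)\<close>, which telescopes, they are. So the
  integral over \<open>[s, t]\<close> minus \<open>f \<xi> * (g t - g s)\<close> is a sum over the levels \<open>n \<ge> N\<close> plus three products
  of increments at level \<open>N\<close> (\<open>Young_Loeve_basic\<close>). Hoelder's inequality, first inside each level
  and then across the levels, bounds it by the local energies. If \<open>a, b\<close> denote the norms
  of the two accumulated energies and \<open>h, k\<close> half the norms of the two Schauder tails, the bound is
  \<open>7 * a * b + 7 * h * b + 2 * a * k + 4 * h * k\<close>, which leaves room below the constant \<open>8\<close>
  (\<open>energy_Young_Loeve\<close>).

  For Hoelder functions all these sequences decay geometrically as soon as \<open>1 / p < \<alpha>\<close> and
  \<open>1 / q < \<beta>\<close>; since \<open>1 - \<beta> < \<alpha>\<close>, the number \<open>1 / p\<close> can be put halfway between. The energy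
  estimate does not see how energy is distributed over a partition, so it does not yield the
  Young integral. For that the same telescoping is run with the pointwise Hoelder bounds. The
  error over \<open>[s, t]\<close> is then of order \<open>(t - s) powr (\<alpha> + \<beta>)\<close> (\<open>hoelder_Young_Loeve\<close>), and because the
  exponent exceeds \<open>1\<close> the errors over a partition add up to something that vanishes with the
  mesh. Finally, the Riemann sums for \<open>f dg\<close> with right tags and for \<open>g df\<close> with left tags
  telescope together, which is integration by parts.
\<close>

section \<open>Finite Hoelder and Minkowski inequalities\<close>

text \<open>
  After normalising both norms to \<open>1\<close>, Young's inequality applied to each term and summed gives
  \<open>1 / p + 1 / q\<close>. If one norm vanishes then so does every product.
\<close>
lemma Hoelder_inequality_sum:
  fixes a b :: "'i \<Rightarrow> real"
  assumes "finite A" "p > 1" "q > 1" "1 / p + 1 / q = 1"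
    and a: "\<And>i. i \<in> A \<Longrightarrow> 0 \<le> a i" and b: "\<And>i. i \<in> A \<Longrightarrow> 0 \<le> b i"
  shows "(\<Sum>i\<in>A. a i * b i) \<le> (\<Sum>i\<in>A. a i powr p) powr (1 / p) * (\<Sum>i\<in>A. b i powr q) powr (1 / q)"
proof -
  define X where "X = (\<Sum>i\<in>A. a i powr p)"
  define Y where "Y = (\<Sum>i\<in>A. b i powr q)"
  have nn: "0 \<le> X" "0 \<le> Y" by (simp_all add: X_def Y_def sum_nonneg)
  show ?thesis
  proof (cases "X = 0 \<or> Y = 0")
    case True
    have "a i * b i = 0" if "i \<in> A" for i
    proof -
      have "a i powr p = 0 \<or> b i powr q = 0"
        using True \<open>finite A\<close> that by (auto simp: X_def Y_def sum_nonneg_eq_0_iff)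
      then show ?thesis by auto
    qed
    then have "(\<Sum>i\<in>A. a i * b i) = 0" by (intro sum.neutral ballI)
    then show ?thesis by simp
  next
    case False
    with nn have pos: "X > 0" "Y > 0" by auto
    define x where "x = X powr (1 / p)"
    define y where "y = Y powr (1 / q)"
    have xy: "x > 0" "y > 0" using pos by (auto simp: x_def y_def)
    have xp: "x powr p = X" "y powr q = Y" using pos assms by (simp_all add: x_def y_def powr_powr)
    have "(\<Sum>i\<in>A. (a i / x) * (b i / y)) \<le> (\<Sum>i\<in>A. (a i / x) powr p / p + (b i / y) powr q / q)"
    proof (rule sum_mono)
      fix i assume "i \<in> A"
      then show "(a i / x) * (b i / y) \<le> (a i / x) powr p / p + (b i / y) powr q / q"
        using assms xy by (intro Youngs_inequality) auto
    qed
    also have "\<dots> = (\<Sum>i\<in>A. (a i powr p / X) / p + (b i powr q / Y) / q)"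
      using a b xy xp by (intro sum.cong) (auto simp: powr_divide)
    also have "\<dots> = (X / X) / p + (Y / Y) / q"
      unfolding sum.distrib by (simp only: sum_divide_distrib[symmetric] X_def[symmetric] Y_def[symmetric])
    also have "\<dots> = 1" using pos assms by simp
    finally have "(\<Sum>i\<in>A. a i * b i) / (x * y) \<le> 1"
      by (simp add: sum_divide_distrib)
    then have "(\<Sum>i\<in>A. a i * b i) \<le> x * y" using xy by (simp add: divide_simps)
    then show ?thesis by (simp add: x_def y_def X_def Y_def)
  qed
qed

text \<open>
  Split \<open>(a + b) powr p = a * (a + b) powr (p - 1) + b * (a + b) powr (p - 1)\<close>, apply Hoelder's
  inequality to both parts, and divide by the common factor.
\<close>
lemma Minkowski_inequality_sum:
  fixes a b :: "'i \<Rightarrow> real"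
  assumes "finite A" "p > 1"
    and a: "\<And>i. i \<in> A \<Longrightarrow> 0 \<le> a i" and b: "\<And>i. i \<in> A \<Longrightarrow> 0 \<le> b i"
  shows "(\<Sum>i\<in>A. (a i + b i) powr p) powr (1 / p)
           \<le> (\<Sum>i\<in>A. a i powr p) powr (1 / p) + (\<Sum>i\<in>A. b i powr p) powr (1 / p)"
proof -
  define q where "q = p / (p - 1)"
  have q: "q > 1" "1 / p + 1 / q = 1" using \<open>p > 1\<close> by (auto simp: q_def field_simps)
  have pq: "(p - 1) * q = p" using \<open>p > 1\<close> by (simp add: q_def)
  define S where "S = (\<Sum>i\<in>A. (a i + b i) powr p)"
  define X where "X = (\<Sum>i\<in>A. a i powr p) powr (1 / p)"
  define Y where "Y = (\<Sum>i\<in>A. b i powr p) powr (1 / p)"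
  have S0: "S \<ge> 0" by (simp add: S_def sum_nonneg)
  show ?thesis
  proof (cases "S = 0")
    case True
    then show ?thesis using S_def by simp
  next
    case False
    with S0 have "S > 0" by simp
    have "S = (\<Sum>i\<in>A. a i * (a i + b i) powr (p - 1)) + (\<Sum>i\<in>A. b i * (a i + b i) powr (p - 1))"
      unfolding S_def sum.distrib[symmetric]
    proof (rule sum.cong)
      fix i assume "i \<in> A"
      then have "0 \<le> a i + b i" using a b by (simp add: add_nonneg_nonneg)
      then have "(a i + b i) powr p = (a i + b i) * (a i + b i) powr (p - 1)"
        by (metis powr_mult_base diff_add_cancel add.commute)
      then show "(a i + b i) powr p = a i * (a i + b i) powr (p - 1) + b i * (a i + b i) powr (p - 1)"
        by (simp add: distrib_right)
    qed simp
    also have "\<dots> \<le> X * S powr (1 / q) + Y * S powr (1 / q)"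
    proof (rule add_mono)
      show "(\<Sum>i\<in>A. a i * (a i + b i) powr (p - 1)) \<le> X * S powr (1 / q)"
        using Hoelder_inequality_sum[OF \<open>finite A\<close> \<open>p > 1\<close> q, of a "\<lambda>i. (a i + b i) powr (p - 1)"] a
        by (simp add: powr_powr pq X_def S_def)
      show "(\<Sum>i\<in>A. b i * (a i + b i) powr (p - 1)) \<le> Y * S powr (1 / q)"
        using Hoelder_inequality_sum[OF \<open>finite A\<close> \<open>p > 1\<close> q, of b "\<lambda>i. (a i + b i) powr (p - 1)"] b
        by (simp add: powr_powr pq Y_def S_def)
    qed
    finally have "S \<le> (X + Y) * S powr (1 / q)" by (simp add: distrib_right)
    moreover have "S = S powr (1 / p) * S powr (1 / q)"
      using \<open>S > 0\<close> q by (simp add: powr_add[symmetric])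
    ultimately have "S powr (1 / p) * S powr (1 / q) \<le> (X + Y) * S powr (1 / q)" by simp
    then have "S powr (1 / p) \<le> X + Y" using \<open>S > 0\<close> by simp
    then show ?thesis by (simp add: S_def X_def Y_def)
  qed
qed

section \<open>Increments over dyadic intervals and accumulated energies\<close>

abbreviation incr :: "(real \<Rightarrow> real) \<Rightarrow> nat \<Rightarrow> nat \<Rightarrow> real" where
  "incr f n k \<equiv> f (dyadic_pt n (Suc k)) - f (dyadic_pt n k)"

definition dyadic_variation :: "real \<Rightarrow> (real \<Rightarrow> real) \<Rightarrow> nat \<Rightarrow> real" where
  "dyadic_variation p f n = (\<Sum>k<2 ^ n. \<bar>incr f n k\<bar> powr p) powr (1 / p)"

lemma dyadic_pt_double: "dyadic_pt (Suc n) (2 * k) = dyadic_pt n k"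
  by (simp add: dyadic_pt_def field_simps)

lemma dyadic_pt_in: "k \<le> 2 ^ n \<Longrightarrow> dyadic_pt n k \<in> {0..1}"
  by (simp add: dyadic_pt_def)

lemma dyadic_variation_nonneg [simp]: "0 \<le> dyadic_variation p f n"
  by (simp add: dyadic_variation_def)

lemma incr_le_dyadic_variation:
  assumes "p > 1" "k < 2 ^ n"
  shows "\<bar>incr f n k\<bar> \<le> dyadic_variation p f n"
proof -
  have "\<bar>incr f n k\<bar> = (\<bar>incr f n k\<bar> powr p) powr (1 / p)"
    using assms by (simp add: powr_powr)
  also have "\<dots> \<le> dyadic_variation p f n" unfolding dyadic_variation_def
    using assms by (intro powr_mono2 member_le_sum) auto
  finally show ?thesis .
qed

text \<open>
  Groups the intervals of one level by their parents in the preceding level.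
\<close>
lemma sum_lessThan_double:
  fixes a :: "nat \<Rightarrow> 'a::comm_monoid_add"
  shows "(\<Sum>k<2 * n. a k) = (\<Sum>k<n. a (2 * k) + a (Suc (2 * k)))"
  by (induction n) (auto simp: algebra_simps)

text \<open>
  The normalisation of the Schauder coefficients cancels: \<open>e = 2 powr (- n / 2) * \<theta>\<close> is twice the
  deviation of the midpoint value from the mean of the two endpoint values.
\<close>
lemma second_difference:
  "2 * f (dyadic_pt (Suc n) (Suc (2 * k))) - f (dyadic_pt n k) - f (dyadic_pt n (Suc k))
     = 2 powr (- (real n / 2)) * schauder_coeff f (int n) k"
proof -
  have "2 powr (- (real n / 2)) * 2 powr (real n / 2) = (1::real)"
    by (simp add: powr_add[symmetric])
  then show ?thesis
    by (simp add: schauder_coeff_def mult.assoc[symmetric])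
qed

lemma incr_refine:
  "incr f (Suc n) (2 * k) = (incr f n k + 2 powr (- (real n / 2)) * schauder_coeff f (int n) k) / 2"
  "incr f (Suc n) (Suc (2 * k)) = (incr f n k - 2 powr (- (real n / 2)) * schauder_coeff f (int n) k) / 2"
  unfolding second_difference[symmetric] using dyadic_pt_double[of n k] dyadic_pt_double[of n "Suc k"]
  by (simp_all add: field_simps)

text \<open>
  The level energy is the \<open>\<ell>\<^sup>p\<close> norm of the second differences of that level.
\<close>
lemma level_energy_nat:
  assumes "p > 1"
  shows "level_energy p f (int n)
    = (\<Sum>k<2 ^ n. \<bar>2 powr (- (real n / 2)) * schauder_coeff f (int n) k\<bar> powr p) powr (1 / p)"
  by (simp add: level_energy_def abs_mult powr_mult sum_distrib_left[symmetric] powr_powr)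

text \<open>
  Every increment of level \<open>n\<close> has two children, each bounded by half the sum of \<open>\<bar>d\<bar>\<close> and \<open>\<bar>e\<bar>\<close>. The
  two children give the factor \<open>2 powr (1 / p)\<close>, the halving gives \<open>1 / 2\<close>.
\<close>
lemma dyadic_variation_Suc_le:
  assumes "p > 1"
  shows "dyadic_variation p f (Suc n)
    \<le> 2 powr (- (1 - 1 / p)) * (dyadic_variation p f n + level_energy p f (int n))"
proof -
  define d where "d k = \<bar>incr f n k\<bar>" for k
  define e where "e k = \<bar>2 powr (- (real n / 2)) * schauder_coeff f (int n) k\<bar>" for k
  have "(\<Sum>k<2 ^ Suc n. \<bar>incr f (Suc n) k\<bar> powr p)
      = (\<Sum>k<2 ^ n. \<bar>incr f (Suc n) (2 * k)\<bar> powr p + \<bar>incr f (Suc n) (Suc (2 * k))\<bar> powr p)"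
    by (simp only: power_Suc sum_lessThan_double)
  also have "\<dots> \<le> (\<Sum>k<2 ^ n. ((d k + e k) / 2) powr p + ((d k + e k) / 2) powr p)"
    unfolding incr_refine d_def e_def using assms
    by (intro sum_mono add_mono powr_mono2) (auto simp: field_simps)
  also have "\<dots> = 2 powr (1 - p) * (\<Sum>k<2 ^ n. (d k + e k) powr p)"
    by (simp add: powr_divide sum_distrib_left d_def e_def powr_diff)
  finally have "dyadic_variation p f (Suc n)
      \<le> (2 powr (1 - p) * (\<Sum>k<2 ^ n. (d k + e k) powr p)) powr (1 / p)"
    unfolding dyadic_variation_def using assms by (intro powr_mono2) (auto intro: sum_nonneg)
  also have "\<dots> = 2 powr (- (1 - 1 / p)) * (\<Sum>k<2 ^ n. (d k + e k) powr p) powr (1 / p)"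
    using assms by (simp add: powr_mult powr_powr sum_nonneg diff_divide_distrib)
  also have "\<dots> \<le> 2 powr (- (1 - 1 / p)) *
      ((\<Sum>k<2 ^ n. d k powr p) powr (1 / p) + (\<Sum>k<2 ^ n. e k powr p) powr (1 / p))"
    using assms by (intro mult_left_mono Minkowski_inequality_sum) (auto simp: d_def e_def)
  finally show ?thesis
    using assms by (simp add: dyadic_variation_def level_energy_nat d_def e_def)
qed

lemma level_energy_nonneg [simp]: "0 \<le> level_energy p f n"
  by (simp add: level_energy_def)

lemma accumulated_energy_0:
  "accumulated_energy p f 0 = 2 powr (- (1 - 1 / p)) * level_energy p f (-1) + level_energy p f 0"
proof -
  have "{-1..0::int} = {-1, 0}" by auto
  then show ?thesis by (simp add: accumulated_energy_def)
qed

lemma accumulated_energy_Suc: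
  "accumulated_energy p f (Suc n)
     = 2 powr (- (1 - 1 / p)) * accumulated_energy p f n + level_energy p f (int (Suc n))"
proof -
  define c where "c = (2::real) powr (- (1 - 1 / p))"
  define w where "w k m = (2::real) powr (- (of_int (k - m) * (1 - 1 / p)))" for k m :: int
  have w: "w (int (Suc n)) m = c * w (int n) m" for m
    unfolding w_def c_def powr_add[symmetric]
    by (rule arg_cong[where f="\<lambda>x. 2 powr x"]) (simp add: algebra_simps)
  have acc: "accumulated_energy p f k = (\<Sum>m\<in>{-1..int k}. w (int k) m * level_energy p f m)" for k
    by (simp add: accumulated_energy_def w_def)
  note acc[of "Suc n"]
  also have "{-1..int (Suc n)} = insert (int (Suc n)) {-1..int n}" by auto
  also have "(\<Sum>m\<in>insert (int (Suc n)) {-1..int n}. w (int (Suc n)) m * level_energy p f m)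
      = level_energy p f (int (Suc n)) + (\<Sum>m\<in>{-1..int n}. w (int (Suc n)) m * level_energy p f m)"
    by (subst sum.insert) (auto simp: w_def)
  also have "(\<Sum>m\<in>{-1..int n}. w (int (Suc n)) m * level_energy p f m) = c * accumulated_energy p f n"
    by (simp only: w acc[of n] sum_distrib_left mult.assoc)
  finally show ?thesis by (simp add: c_def)
qed

lemma accumulated_energy_nonneg [simp]: "0 \<le> accumulated_energy p f n"
  by (simp add: accumulated_energy_def sum_nonneg)

text \<open>
  The sharp bound for level \<open>n + 1\<close>, with the factor \<open>2 powr (- (1 - 1 / p))\<close>, is what the induction
  propagates: together with the level energy of level \<open>n + 1\<close> it gives the accumulated energy of that level.
  At level \<open>0\<close> the only increment is \<open>f 1 - f 0\<close>, and the weight in the level energy of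
  level \<open>-1\<close> is chosen so that the same recursion starts there.
\<close>
lemma dyadic_variation_accumulated:
  assumes "p > 1"
  shows "dyadic_variation p f n \<le> accumulated_energy p f n
       \<and> dyadic_variation p f (Suc n) \<le> 2 powr (- (1 - 1 / p)) * accumulated_energy p f n"
proof (induction n)
  case 0
  have 1: "dyadic_variation p f 0 = 2 powr (- (1 - 1 / p)) * level_energy p f (-1)"
  proof -
    have "(2::real) powr (- (1 - 1 / p)) * 2 powr (1 - 1 / p) = 1"
      by (simp add: powr_add[symmetric])
    then show ?thesis using assms
      by (simp add: dyadic_variation_def level_energy_def schauder_coeff_def dyadic_pt_def powr_powr
          mult.assoc[symmetric])
  qed
  then have "dyadic_variation p f 0 + level_energy p f 0 = accumulated_energy p f 0"
    by (simp add: accumulated_energy_0)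
  with dyadic_variation_Suc_le[OF assms, of f 0] 1 show ?case
    by (simp add: accumulated_energy_0)
next
  case (Suc n)
  have 1: "dyadic_variation p f (Suc n) + level_energy p f (int (Suc n)) \<le> accumulated_energy p f (Suc n)"
    using Suc by (simp add: accumulated_energy_Suc)
  have "dyadic_variation p f (Suc (Suc n))
      \<le> 2 powr (- (1 - 1 / p)) * (dyadic_variation p f (Suc n) + level_energy p f (int (Suc n)))"
    by (rule dyadic_variation_Suc_le[OF assms])
  also have "\<dots> \<le> 2 powr (- (1 - 1 / p)) * accumulated_energy p f (Suc n)"
    using 1 by (intro mult_left_mono) auto
  finally show ?case using 1 level_energy_nonneg[of p f "int (Suc n)"] by linarith
qed

lemma dyadic_variation_le:
  assumes "p > 1"
  shows "dyadic_variation p f n \<le> accumulated_energy p f n"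
    and "dyadic_variation p f (Suc n) \<le> accumulated_energy p f n"
proof -
  show "dyadic_variation p f n \<le> accumulated_energy p f n"
    using dyadic_variation_accumulated[OF assms] by blast
  have "2 powr (- (1 - 1 / p)) * accumulated_energy p f n \<le> 1 * accumulated_energy p f n"
    using assms powr_mono[of "- (1 - 1 / p)" 0 2] by (intro mult_right_mono) auto
  then show "dyadic_variation p f (Suc n) \<le> accumulated_energy p f n"
    using dyadic_variation_accumulated[OF assms, of f n] by simp
qed

section \<open>Dyadic approximation from below and linear interpolation\<close>

definition dyadic_index :: "nat \<Rightarrow> real \<Rightarrow> nat" where
  "dyadic_index n x = nat \<lfloor>2 ^ n * x\<rfloor>"

definition dyadic_floor :: "nat \<Rightarrow> real \<Rightarrow> real" where
  "dyadic_floor n x = dyadic_pt n (dyadic_index n x)"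

lemma dyadic_index_bounds:
  assumes "0 \<le> x"
  shows "real (dyadic_index n x) \<le> 2 ^ n * x" "2 ^ n * x < real (dyadic_index n x) + 1"
  using assms by (simp_all add: dyadic_index_def)

lemma dyadic_floor_bounds:
  assumes "0 \<le> x"
  shows "0 \<le> dyadic_floor n x" "dyadic_floor n x \<le> x" "x < dyadic_floor n x + 1 / 2 ^ n"
  using dyadic_index_bounds[OF assms, of n]
  by (simp_all add: dyadic_floor_def dyadic_pt_def field_simps)

lemma dyadic_index_le:
  assumes "0 \<le> x" "x \<le> 1"
  shows "dyadic_index n x \<le> 2 ^ n"
proof -
  have "real (dyadic_index n x) \<le> 2 ^ n * x" using dyadic_index_bounds assms by blast
  also have "\<dots> \<le> 2 ^ n" using assms by simp
  finally show ?thesis by simp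
qed

lemma dyadic_index_less:
  assumes "0 \<le> x" "x < 1"
  shows "dyadic_index n x < 2 ^ n"
proof -
  have "real (dyadic_index n x) \<le> 2 ^ n * x" using dyadic_index_bounds assms by blast
  also have "\<dots> < 2 ^ n" using assms by simp
  finally show ?thesis by simp
qed

lemma dyadic_index_mono: "x \<le> y \<Longrightarrow> dyadic_index n x \<le> dyadic_index n y"
  unfolding dyadic_index_def by (intro nat_mono floor_mono) simp

lemma dyadic_index_1 [simp]: "dyadic_index n 1 = 2 ^ n"
  by (simp add: dyadic_index_def nat_power_eq)

lemma dyadic_floor_1 [simp]: "dyadic_floor n 1 = 1"
  by (simp add: dyadic_floor_def dyadic_pt_def)

lemma dyadic_index_Suc:
  assumes "0 \<le> x"
  obtains "dyadic_index (Suc n) x = 2 * dyadic_index n x"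
  | "dyadic_index (Suc n) x = Suc (2 * dyadic_index n x)"
proof -
  have "real (2 * dyadic_index n x) < real (dyadic_index (Suc n) x) + 1"
    "real (dyadic_index (Suc n) x) < real (2 * dyadic_index n x) + 2"
    using dyadic_index_bounds[OF assms, of n] dyadic_index_bounds[OF assms, of "Suc n"] by simp_all
  then have "2 * dyadic_index n x < dyadic_index (Suc n) x + 1"
    "dyadic_index (Suc n) x < 2 * dyadic_index n x + 2" by linarith+
  then show thesis using that by linarith
qed

text \<open>
  At the scale \<open>2\<^sup>-\<^sup>n\<close> two points lie in the same or in neighbouring grid intervals.
\<close>
lemma dyadic_index_near:
  assumes "0 \<le> s" "s \<le> t" "t - s \<le> 1 / 2 ^ n"
  shows "dyadic_index n t = dyadic_index n s \<or> dyadic_index n t = Suc (dyadic_index n s)"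
proof -
  have "2 ^ n * t - 2 ^ n * s \<le> 1" using assms by (simp add: field_simps)
  then have "real (dyadic_index n t) < real (dyadic_index n s) + 2"
    using dyadic_index_bounds[of s n] dyadic_index_bounds[of t n] assms by linarith
  then have "dyadic_index n t < dyadic_index n s + 2" by linarith
  then show ?thesis using dyadic_index_mono[of s t n] assms by linarith
qed

lemma dyadic_floor_tendsto:
  assumes "0 \<le> x"
  shows "(\<lambda>n. dyadic_floor n x) \<longlonglongrightarrow> x"
proof (rule tendsto_sandwich)
  have "(\<lambda>n. x - (1 / 2) ^ n) \<longlonglongrightarrow> x - 0"
    by (intro tendsto_intros LIMSEQ_realpow_zero) auto
  then show "(\<lambda>n. x - 1 / 2 ^ n) \<longlonglongrightarrow> x" by (simp add: power_divide)
  show "\<forall>\<^sub>F n in sequentially. x - 1 / 2 ^ n \<le> dyadic_floor n x"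
    using dyadic_floor_bounds[OF assms] by (intro always_eventually allI) (smt (verit))
  show "\<forall>\<^sub>F n in sequentially. dyadic_floor n x \<le> x"
    using dyadic_floor_bounds[OF assms] by simp
qed simp

lemma continuous_dyadic_floor_tendsto:
  assumes "continuous_on {0..1} f" "x \<in> {0..1}"
  shows "(\<lambda>n. f (dyadic_floor n x)) \<longlonglongrightarrow> f x"
proof (rule continuous_on_tendsto_compose[OF assms(1)])
  show "(\<lambda>n. dyadic_floor n x) \<longlonglongrightarrow> x" using assms dyadic_floor_tendsto by simp
  show "\<forall>\<^sub>F n in sequentially. dyadic_floor n x \<in> {0..1}"
    using assms dyadic_floor_bounds[of x] by (intro always_eventually allI) (smt (verit) atLeastAtMost_iff)
qed (use assms in auto)

text \<open>
  The linear interpolation of \<open>f\<close> between the points of level \<open>n\<close>. At \<open>x = 1\<close> the increment reaches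
  outside the unit interval, but its coefficient is \<open>0\<close> there.
\<close>
definition dyadic_interp :: "nat \<Rightarrow> (real \<Rightarrow> real) \<Rightarrow> real \<Rightarrow> real" where
  "dyadic_interp n f x =
     f (dyadic_floor n x) + (2 ^ n * x - real (dyadic_index n x)) * incr f n (dyadic_index n x)"

text \<open>
  The summands of the Schauder tail; half of this number is the largest tent height at level \<open>m\<close>.
\<close>
definition level_sup :: "(real \<Rightarrow> real) \<Rightarrow> nat \<Rightarrow> real" where
  "level_sup f m = 2 powr (- (real m / 2)) * (SUP k\<in>{..<2 ^ m}. \<bar>schauder_coeff f (int m) k\<bar>)"

lemma schauder_coeff_le_level_sup:
  assumes "k < 2 ^ m"
  shows "\<bar>2 powr (- (real m / 2)) * schauder_coeff f (int m) k\<bar> \<le> level_sup f m"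
  unfolding level_sup_def abs_mult using assms
  by (auto intro!: mult_left_mono cSUP_upper bdd_above_finite)

lemma level_sup_nonneg [simp]: "0 \<le> level_sup f m"
  using schauder_coeff_le_level_sup[of 0 m f] by simp

text \<open>
  The two interpolations differ by a tent over each interval of level \<open>n\<close>, whose height at the midpoint
  is \<open>\<bar>e\<bar> / 2\<close>. The two cases are the rising and the falling half of the tent.
\<close>
lemma dyadic_interp_Suc:
  assumes "x \<in> {0..1}"
  shows "\<bar>dyadic_interp (Suc n) f x - dyadic_interp n f x\<bar> \<le> level_sup f n / 2"
proof (cases "x = 1")
  case True
  then show ?thesis by (simp add: dyadic_interp_def)
next
  case False
  then have x: "0 \<le> x" "x < 1" using assms by auto
  define k where "k = dyadic_index n x"
  define u where "u = 2 ^ n * x - real k"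
  define e where "e = 2 powr (- (real n / 2)) * schauder_coeff f (int n) k"
  have k: "k < 2 ^ n" using dyadic_index_less[OF x] by (simp add: k_def)
  \<comment> \<open>\<open>e\<close> is twice the height of the tent, so the tent equals \<open>u * e\<close> on the left half
    and \<open>(1 - u) * e\<close> on the right half.\<close>
  have e: "\<bar>e\<bar> \<le> level_sup f n" unfolding e_def by (rule schauder_coeff_le_level_sup[OF k])
  have u: "0 \<le> u" "u < 1" using dyadic_index_bounds[of x n] x by (auto simp: u_def k_def)
  note R = incr_refine[of f n k, folded e_def]
  from x(1) show ?thesis
  proof (cases rule: dyadic_index_Suc[where n=n])
    case 1
    have "u \<le> 1 / 2" using dyadic_index_bounds[of x "Suc n"] x 1 by (simp add: u_def k_def)
    have "dyadic_interp (Suc n) f x - dyadic_interp n f x = u * e"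
      unfolding dyadic_interp_def dyadic_floor_def 1 k_def[symmetric] R u_def
      unfolding dyadic_pt_double by (simp add: field_simps)
    then have "\<bar>dyadic_interp (Suc n) f x - dyadic_interp n f x\<bar> = u * \<bar>e\<bar>"
      using u by (simp add: abs_mult)
    also have "\<dots> \<le> (1 / 2) * level_sup f n" using \<open>u \<le> 1 / 2\<close> u e by (intro mult_mono) auto
    finally show ?thesis by simp
  next
    case 2
    have "1 / 2 \<le> u" using dyadic_index_bounds[of x "Suc n"] x 2 by (simp add: u_def k_def)
    have "f (dyadic_pt (Suc n) (Suc (2 * k))) = f (dyadic_pt n k) + (incr f n k + e) / 2"
      using R(1) unfolding dyadic_pt_double by linarith
    then have "dyadic_interp (Suc n) f x - dyadic_interp n f x = (1 - u) * e"
      unfolding dyadic_interp_def dyadic_floor_def 2 k_def[symmetric] R u_def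
      by (simp add: field_simps)
    then have "\<bar>dyadic_interp (Suc n) f x - dyadic_interp n f x\<bar> = (1 - u) * \<bar>e\<bar>"
      using u by (simp add: abs_mult)
    also have "\<dots> \<le> (1 / 2) * level_sup f n" using \<open>1 / 2 \<le> u\<close> u e by (intro mult_mono) auto
    finally show ?thesis by simp
  qed
qed

lemma dyadic_interp_tendsto:
  assumes "continuous_on {0..1} f" "x \<in> {0..1}"
  shows "(\<lambda>n. dyadic_interp n f x) \<longlonglongrightarrow> f x"
proof (cases "x = 1")
  case True
  then show ?thesis by (simp add: dyadic_interp_def)
next
  case False
  then have x: "0 \<le> x" "x < 1" using assms by auto
  define y where "y n = dyadic_pt n (Suc (dyadic_index n x))" for n
  have y: "y n = dyadic_floor n x + (1 / 2) ^ n" for n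
    by (simp add: y_def dyadic_floor_def dyadic_pt_def add_divide_distrib power_divide)
  have "(\<lambda>n. f (y n)) \<longlonglongrightarrow> f x"
  proof (rule continuous_on_tendsto_compose[OF assms(1)])
    have "(\<lambda>n. dyadic_floor n x + (1 / 2) ^ n) \<longlonglongrightarrow> x + 0"
      using dyadic_floor_tendsto[OF x(1)] by (intro tendsto_intros LIMSEQ_realpow_zero) auto
    then show "y \<longlonglongrightarrow> x" unfolding y[symmetric] by simp
    show "\<forall>\<^sub>F n in sequentially. y n \<in> {0..1}"
      unfolding y_def using dyadic_index_less[OF x]
      by (intro always_eventually allI dyadic_pt_in) (simp add: Suc_leI)
  qed (use assms in auto)
  moreover note continuous_dyadic_floor_tendsto[OF assms]
  ultimately have "(\<lambda>n. \<bar>f (dyadic_floor n x) - f x\<bar> + \<bar>f (y n) - f x\<bar>) \<longlonglongrightarrow> \<bar>f x - f x\<bar> + \<bar>f x - f x\<bar>"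
    by (intro tendsto_intros)
  then have "(\<lambda>n. \<bar>f (dyadic_floor n x) - f x\<bar> + \<bar>f (y n) - f x\<bar>) \<longlonglongrightarrow> 0" by simp
  then have "(\<lambda>n. dyadic_interp n f x - f x) \<longlonglongrightarrow> 0"
  proof (rule Lim_null_comparison[rotated], intro always_eventually allI)
    fix n
    define u where "u = 2 ^ n * x - real (dyadic_index n x)"
    have u: "0 \<le> u" "u \<le> 1" using dyadic_index_bounds[of x n] x by (auto simp: u_def)
    have "dyadic_interp n f x - f x = (1 - u) * (f (dyadic_floor n x) - f x) + u * (f (y n) - f x)"
      by (simp add: dyadic_interp_def y_def u_def dyadic_floor_def algebra_simps)
    also have "\<bar>\<dots>\<bar> \<le> (1 - u) * \<bar>f (dyadic_floor n x) - f x\<bar> + u * \<bar>f (y n) - f x\<bar>"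
      using u by (intro order_trans[OF abs_triangle_ineq]) (simp add: abs_mult)
    also have "\<dots> \<le> 1 * \<bar>f (dyadic_floor n x) - f x\<bar> + 1 * \<bar>f (y n) - f x\<bar>"
      using u by (intro add_mono mult_right_mono) auto
    finally show "norm (dyadic_interp n f x - f x) \<le> \<bar>f (dyadic_floor n x) - f x\<bar> + \<bar>f (y n) - f x\<bar>"
      by simp
  qed
  then show ?thesis by (simp add: LIM_zero_iff)
qed

definition level_sup_tail :: "(real \<Rightarrow> real) \<Rightarrow> nat \<Rightarrow> real" where
  "level_sup_tail f n = (\<Sum>j. level_sup f (n + j))"

lemma summable_level_sup_shift: "summable (level_sup f) \<Longrightarrow> summable (\<lambda>j. level_sup f (n + j))"
  by (subst add.commute) (rule summable_ignore_initial_segment)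

lemma level_sup_tail_nonneg:
  "summable (level_sup f) \<Longrightarrow> 0 \<le> level_sup_tail f n"
  unfolding level_sup_tail_def by (intro suminf_nonneg summable_level_sup_shift) auto

text \<open>
  The interpolations converge to \<open>f\<close>, and each further level moves them by at most half its largest tent.
\<close>
lemma dyadic_interp_error:
  assumes "continuous_on {0..1} f" "summable (level_sup f)" "x \<in> {0..1}"
  shows "\<bar>f x - dyadic_interp n f x\<bar> \<le> level_sup_tail f n / 2"
proof -
  have *: "\<bar>dyadic_interp (n + m) f x - dyadic_interp n f x\<bar> \<le> (\<Sum>j<m. level_sup f (n + j)) / 2" for m
  proof (induction m)
    case (Suc m)
    have "(\<Sum>j<Suc m. level_sup f (n + j)) = (\<Sum>j<m. level_sup f (n + j)) + level_sup f (n + m)"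
      by simp
    with Suc dyadic_interp_Suc[OF assms(3), of "n + m" f] show ?case
      unfolding add_Suc_right by argo
  qed simp
  have "\<bar>dyadic_interp (n + m) f x - dyadic_interp n f x\<bar> \<le> level_sup_tail f n / 2" for m
  proof -
    have "(\<Sum>j<m. level_sup f (n + j)) \<le> level_sup_tail f n"
      unfolding level_sup_tail_def by (intro sum_le_suminf summable_level_sup_shift assms) auto
    with *[of m] show ?thesis by linarith
  qed
  moreover have "(\<lambda>m. \<bar>dyadic_interp (n + m) f x - dyadic_interp n f x\<bar>) \<longlonglongrightarrow> \<bar>f x - dyadic_interp n f x\<bar>"
    using LIMSEQ_ignore_initial_segment[OF dyadic_interp_tendsto[OF assms(1,3)], of n]
    by (intro tendsto_intros) (simp add: add.commute)
  ultimately show ?thesis by (intro LIMSEQ_le_const2) auto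
qed

text \<open>
  The interpolation agrees with \<open>f\<close> at the grid point, so the interpolation error is paid only once.
  In \<open>oscillation_le\<close> neither point need be on the grid and it is paid twice.
\<close>
lemma abs_diff_dyadic_floor_le:
  assumes "continuous_on {0..1} f" "summable (level_sup f)" "x \<in> {0..1}"
    and V: "\<And>k. k < 2 ^ n \<Longrightarrow> \<bar>incr f n k\<bar> \<le> V"
  shows "\<bar>f x - f (dyadic_floor n x)\<bar> \<le> V + level_sup_tail f n / 2"
proof -
  have "0 \<le> V" using V[of 0] by simp
  show ?thesis
  proof (cases "x = 1")
    case True
    then show ?thesis using \<open>0 \<le> V\<close> level_sup_tail_nonneg[OF assms(2), of n] by simp
  next
    case False
    then have x: "0 \<le> x" "x < 1" using assms by auto
    define u where "u = 2 ^ n * x - real (dyadic_index n x)"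
    have u: "0 \<le> u" "u \<le> 1" using dyadic_index_bounds[of x n] x by (auto simp: u_def)
    have "\<bar>u * incr f n (dyadic_index n x)\<bar> \<le> 1 * V"
      unfolding abs_mult using u V[OF dyadic_index_less[OF x]] by (intro mult_mono) auto
    moreover have "f x - f (dyadic_floor n x) = (f x - dyadic_interp n f x) + u * incr f n (dyadic_index n x)"
      by (simp add: dyadic_interp_def u_def)
    ultimately show ?thesis using dyadic_interp_error[OF assms(1-3), of n] by linarith
  qed
qed

text \<open>
  The interpolation has slope at most \<open>2 ^ n * V\<close>. If \<open>x\<close> and \<open>y\<close> lie in neighbouring intervals, the
  portions \<open>1 - u\<close> and \<open>v\<close> of the two intervals that lie between them add up to at most \<open>1\<close>.
\<close>
lemma dyadic_interp_oscillation:
  assumes xy: "0 \<le> x" "x \<le> y" "y \<le> 1" "y - x \<le> 1 / 2 ^ n"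
    and V: "\<And>k. k < 2 ^ n \<Longrightarrow> \<bar>incr f n k\<bar> \<le> V"
  shows "\<bar>dyadic_interp n f y - dyadic_interp n f x\<bar> \<le> V"
proof (cases "x = 1")
  case True
  then show ?thesis using xy V[of 0] by simp
next
  case False
  then have x: "0 \<le> x" "x < 1" using xy by auto
  define k where "k = dyadic_index n x"
  define u where "u = 2 ^ n * x - real k"
  have u: "0 \<le> u" "u \<le> 1" using dyadic_index_bounds[of x n] x by (auto simp: u_def k_def)
  have d: "2 ^ n * y - 2 ^ n * x \<le> 1" "0 \<le> 2 ^ n * y - 2 ^ n * x" using xy by (simp_all add: field_simps)
  have Vk: "\<bar>incr f n k\<bar> \<le> V" unfolding k_def by (rule V[OF dyadic_index_less[OF x]])
  have y0: "0 \<le> y" using xy by simp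
  consider "dyadic_index n y = k" | "dyadic_index n y = Suc k"
    using dyadic_index_near[OF xy(1,2,4)] by (auto simp: k_def)
  then show ?thesis
  proof cases
    case 1
    have "dyadic_interp n f y - dyadic_interp n f x = (2 ^ n * y - 2 ^ n * x) * incr f n k"
      unfolding dyadic_interp_def dyadic_floor_def 1 k_def[symmetric] by (simp add: algebra_simps)
    then have "\<bar>dyadic_interp n f y - dyadic_interp n f x\<bar> = \<bar>2 ^ n * y - 2 ^ n * x\<bar> * \<bar>incr f n k\<bar>"
      by (simp add: abs_mult)
    also have "\<dots> \<le> 1 * V" using d Vk by (intro mult_mono) auto
    finally show ?thesis by simp
  next
    case 2
    define v where "v = 2 ^ n * y - real (Suc k)"
    have v: "0 \<le> v" using dyadic_index_bounds[OF y0, of n] 2 by (simp add: v_def)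
    have uv: "(1 - u) + v \<le> 1" using d by (simp add: u_def v_def)
    have vV: "\<bar>v * incr f n (Suc k)\<bar> \<le> v * V"
    \<comment> \<open>If \<open>y = 1\<close>, the interval to the right of \<open>y\<close> is outside \<open>[0, 1]\<close>, but then \<open>v = 0\<close>.\<close>
    proof (cases "Suc k < 2 ^ n")
      case True
      then show ?thesis using V v by (simp add: abs_mult mult_left_mono)
    next
      case False
      then have "2 ^ n \<le> Suc k" by simp
      then have "(2::real) ^ n \<le> real (Suc k)" by (metis of_nat_le_iff of_nat_numeral of_nat_power)
      moreover have "2 ^ n * y \<le> 2 ^ n" using xy by simp
      ultimately have "v = 0" using v unfolding v_def by linarith
      then show ?thesis by simp
    qed
    have "dyadic_interp n f y - dyadic_interp n f x = (1 - u) * incr f n k + v * incr f n (Suc k)"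
      unfolding dyadic_interp_def dyadic_floor_def 2 k_def[symmetric]
      by (simp add: u_def v_def algebra_simps)
    also have "\<bar>\<dots>\<bar> \<le> (1 - u) * V + v * V"
      using u Vk vV by (intro order_trans[OF abs_triangle_ineq] add_mono) (auto simp: abs_mult mult_left_mono)
    also have "\<dots> = ((1 - u) + v) * V" by (simp add: algebra_simps)
    also have "\<dots> \<le> 1 * V" using uv Vk by (intro mult_right_mono) auto
    finally show ?thesis by simp
  qed
qed

lemma oscillation_le:
  assumes "continuous_on {0..1} f" "summable (level_sup f)"
    and xy: "0 \<le> x" "x \<le> y" "y \<le> 1" "y - x \<le> 1 / 2 ^ n"
    and V: "\<And>k. k < 2 ^ n \<Longrightarrow> \<bar>incr f n k\<bar> \<le> V"
  shows "\<bar>f y - f x\<bar> \<le> V + level_sup_tail f n"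
proof -
  have "\<bar>f x - dyadic_interp n f x\<bar> \<le> level_sup_tail f n / 2"
    "\<bar>f y - dyadic_interp n f y\<bar> \<le> level_sup_tail f n / 2"
    using xy dyadic_interp_error[OF assms(1,2)] by simp_all
  moreover have "\<bar>dyadic_interp n f y - dyadic_interp n f x\<bar> \<le> V"
    by (rule dyadic_interp_oscillation[OF xy V])
  ultimately show ?thesis by argo
qed

lemma incr_dyadic_floor_le:
  assumes xy: "0 \<le> x" "x \<le> y" "y \<le> 1" "y - x \<le> 1 / 2 ^ n"
    and V: "\<And>k. k < 2 ^ n \<Longrightarrow> \<bar>incr f n k\<bar> \<le> V"
  shows "\<bar>f (dyadic_floor n y) - f (dyadic_floor n x)\<bar> \<le> V"
proof -
  have "0 \<le> V" using V[of 0] by simp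
  moreover have "dyadic_index n y \<le> 2 ^ n" using dyadic_index_le xy by simp
  ultimately show ?thesis
    using dyadic_index_near[OF xy(1,2,4)] V[of "dyadic_index n x"] by (auto simp: dyadic_floor_def)
qed

lemma incr_dyadic_floor_Suc_le:
  assumes x: "0 \<le> x" "x \<le> 1"
    and V: "\<And>k. k < 2 ^ Suc n \<Longrightarrow> \<bar>incr f (Suc n) k\<bar> \<le> V"
  shows "\<bar>f (dyadic_floor (Suc n) x) - f (dyadic_floor n x)\<bar> \<le> V"
proof -
  have V0: "0 \<le> V" using V[of 0] by simp
  have le: "dyadic_index (Suc n) x \<le> 2 ^ Suc n" using dyadic_index_le x by blast
  from x(1) show ?thesis
  proof (cases rule: dyadic_index_Suc[where n=n])
    case 1
    then show ?thesis using V0 unfolding dyadic_floor_def by (simp add: dyadic_pt_double)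
  next
    case 2
    then have "2 * dyadic_index n x < 2 ^ Suc n" using le by simp
    from V[OF this] show ?thesis unfolding dyadic_floor_def 2 by (simp add: dyadic_pt_double)
  qed
qed

section \<open>Refinement of left sums\<close>

text \<open>
  The change of the left sum over one interval when its midpoint is inserted.
\<close>
abbreviation sewing_term :: "(real \<Rightarrow> real) \<Rightarrow> (real \<Rightarrow> real) \<Rightarrow> nat \<Rightarrow> nat \<Rightarrow> real" where
  "sewing_term f g n k \<equiv> incr f (Suc n) (2 * k) * incr g (Suc n) (Suc (2 * k))"

text \<open>
  Besides the sewing terms of the old intervals, the new level contributes an additional interval
  exactly if the grid point below \<open>x\<close> moves. The second summand is its contribution, and it is \<open>0\<close> otherwise.
\<close>
lemma left_sum_refine:
  assumes "0 \<le> x"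
  shows "left_sum f g x (Suc n) - left_sum f g x n =
    (\<Sum>k<dyadic_index n x. sewing_term f g n k)
      + f (dyadic_floor n x) * (g (dyadic_floor (Suc n) x) - g (dyadic_floor n x))"
proof -
  define K where "K = dyadic_index n x"
  have pair: "f (dyadic_pt (Suc n) (2 * k)) * incr g (Suc n) (2 * k)
      + f (dyadic_pt (Suc n) (Suc (2 * k))) * incr g (Suc n) (Suc (2 * k))
      = f (dyadic_pt n k) * incr g n k + sewing_term f g n k" for k
    using dyadic_pt_double[of n k] dyadic_pt_double[of n "Suc k"] by (simp add: algebra_simps)
  have even: "(\<Sum>k<2 * K. f (dyadic_pt (Suc n) k) * incr g (Suc n) k)
      = left_sum f g x n + (\<Sum>k<K. sewing_term f g n k)"
    unfolding sum_lessThan_double pair by (simp add: left_sum_def dyadic_index_def[symmetric] sum.distrib K_def)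
  from assms show ?thesis
  proof (cases rule: dyadic_index_Suc[where n=n])
    case 1
    then have "left_sum f g x (Suc n) = (\<Sum>k<2 * K. f (dyadic_pt (Suc n) k) * incr g (Suc n) k)"
      unfolding left_sum_def dyadic_index_def[symmetric] 1 K_def by simp
    then show ?thesis using even 1 by (simp add: dyadic_floor_def dyadic_pt_double K_def)
  next
    case 2
    then have "left_sum f g x (Suc n) = (\<Sum>k<Suc (2 * K). f (dyadic_pt (Suc n) k) * incr g (Suc n) k)"
      unfolding left_sum_def dyadic_index_def[symmetric] 2 K_def by simp
    then show ?thesis using even 2 by (simp add: dyadic_floor_def dyadic_pt_double K_def)
  qed
qed

text \<open>
  The boundary terms of \<open>left_sum_refine\<close> at \<open>t\<close> and \<open>s\<close> are compared with \<open>f t\<close> and \<open>f s\<close> instead of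
  \<open>f \<xi>\<close>: the differences \<open>f t - f t\<^sub>j\<close> become small with \<open>j\<close>, and the part that is subtracted telescopes to
  \<open>f t * (g t - g t\<^sub>N)\<close> and \<open>f s * (g s - g s\<^sub>N)\<close>. At the starting level \<open>N\<close> there is at most one grid interval
  between \<open>s\<^sub>N\<close> and \<open>t\<^sub>N\<close>, which leaves one explicit term. The bound \<open>E\<close> is kept abstract since it is supplied once
  by Hoelder continuity and once by the energies; \<open>c\<close> is later the value \<open>f \<xi>\<close>.
\<close>
lemma Young_Loeve_basic:
  fixes f g :: "real \<Rightarrow> real"
  assumes st: "0 \<le> s" "s \<le> t" "t \<le> 1" "t - s \<le> 1 / 2 ^ N"
    and g: "continuous_on {0..1} g"
    and lim: "left_sum f g t \<longlonglongrightarrow> It" "left_sum f g s \<longlonglongrightarrow> Is"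
    and E: "\<And>n. (\<Sum>j\<in>{N..<n}. (\<Sum>k\<in>{dyadic_index j s..<dyadic_index j t}. \<bar>sewing_term f g j k\<bar>)
         + \<bar>f t - f (dyadic_floor j t)\<bar> * \<bar>g (dyadic_floor (Suc j) t) - g (dyadic_floor j t)\<bar>
         + \<bar>f s - f (dyadic_floor j s)\<bar> * \<bar>g (dyadic_floor (Suc j) s) - g (dyadic_floor j s)\<bar>) \<le> E"
  shows "\<bar>It - Is - c * (g t - g s)\<bar> \<le> E
    + \<bar>f (dyadic_floor N s) - c\<bar> * \<bar>g (dyadic_floor N t) - g (dyadic_floor N s)\<bar>
    + \<bar>f t - c\<bar> * \<bar>g t - g (dyadic_floor N t)\<bar>
    + \<bar>f s - c\<bar> * \<bar>g s - g (dyadic_floor N s)\<bar>"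
proof -
  have t0: "0 \<le> t" using st by simp
  define sw where "sw j = (\<Sum>k\<in>{dyadic_index j s..<dyadic_index j t}. sewing_term f g j k)" for j
  define rt where "rt j = (f t - f (dyadic_floor j t)) * (g (dyadic_floor (Suc j) t) - g (dyadic_floor j t))" for j
  define rs where "rs j = (f s - f (dyadic_floor j s)) * (g (dyadic_floor (Suc j) s) - g (dyadic_floor j s))" for j
  define G where "G j = left_sum f g t j - left_sum f g s j
      - f t * g (dyadic_floor j t) + f s * g (dyadic_floor j s)" for j
  have split: "sum h {..<dyadic_index j t} = sum h {..<dyadic_index j s}
      + sum h {dyadic_index j s..<dyadic_index j t}" for h :: "nat \<Rightarrow> real" and j
    unfolding lessThan_atLeast0 using dyadic_index_mono[OF st(2)] by (intro sum.atLeastLessThan_concat[symmetric]) auto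
  have step: "G (Suc j) - G j = sw j - rt j + rs j" for j
  proof -
    note left_sum_refine[OF t0, of f g j] left_sum_refine[OF st(1), of f g j]
      split[of "\<lambda>k. sewing_term f g j k" j]
    then show ?thesis unfolding G_def sw_def rt_def rs_def by (simp add: algebra_simps)
  qed
  have "G n - G N = (\<Sum>j\<in>{N..<n}. sw j - rt j + rs j)" if "N \<le> n" for n
    unfolding step[symmetric] using that by (simp add: sum_Suc_diff')
  moreover have "\<bar>\<Sum>j\<in>{N..<n}. sw j - rt j + rs j\<bar> \<le> E" for n
  proof -
    have "\<bar>\<Sum>j\<in>{N..<n}. sw j - rt j + rs j\<bar> \<le> (\<Sum>j\<in>{N..<n}. \<bar>sw j - rt j + rs j\<bar>)"
      by (rule sum_abs)
    also have "\<dots> \<le> (\<Sum>j\<in>{N..<n}. (\<Sum>k\<in>{dyadic_index j s..<dyadic_index j t}. \<bar>sewing_term f g j k\<bar>)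
         + \<bar>rt j\<bar> + \<bar>rs j\<bar>)"
    proof (rule sum_mono)
      fix j
      have "\<bar>sw j\<bar> \<le> (\<Sum>k\<in>{dyadic_index j s..<dyadic_index j t}. \<bar>sewing_term f g j k\<bar>)"
        unfolding sw_def by (rule sum_abs)
      then show "\<bar>sw j - rt j + rs j\<bar> \<le> (\<Sum>k\<in>{dyadic_index j s..<dyadic_index j t}. \<bar>sewing_term f g j k\<bar>)
         + \<bar>rt j\<bar> + \<bar>rs j\<bar>" by linarith
    qed
    also have "\<dots> \<le> E" using E[of n] by (simp add: rt_def rs_def abs_mult)
    finally show ?thesis .
  qed
  ultimately have "\<bar>G n - G N\<bar> \<le> E" if "N \<le> n" for n using that by metis
  moreover have "(\<lambda>n. \<bar>G n - G N\<bar>) \<longlonglongrightarrow> \<bar>It - Is - f t * g t + f s * g s - G N\<bar>"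
    unfolding G_def using st
    by (intro tendsto_intros lim continuous_dyadic_floor_tendsto[OF g]) auto
  ultimately have lim_le: "\<bar>It - Is - f t * g t + f s * g s - G N\<bar> \<le> E"
    by (intro LIMSEQ_le_const2) auto
  have "left_sum f g t N - left_sum f g s N
      = f (dyadic_floor N s) * (g (dyadic_floor N t) - g (dyadic_floor N s))"
    using dyadic_index_near[OF st(1,2,4)] split[of "\<lambda>k. f (dyadic_pt N k) * incr g N k" N]
    by (auto simp: left_sum_def dyadic_index_def[symmetric] dyadic_floor_def)
  then have "It - Is - c * (g t - g s) = (It - Is - f t * g t + f s * g s - G N)
    + (f (dyadic_floor N s) - c) * (g (dyadic_floor N t) - g (dyadic_floor N s))
    + (f t - c) * (g t - g (dyadic_floor N t))
    - (f s - c) * (g s - g (dyadic_floor N s))"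
    unfolding G_def by (simp add: algebra_simps)
  then show ?thesis using lim_le unfolding abs_mult[symmetric] by linarith
qed

section \<open>Hoelder continuity at dyadic scales\<close>

definition hoelder_bound :: "real \<Rightarrow> real \<Rightarrow> (real \<Rightarrow> real) \<Rightarrow> bool" where
  "hoelder_bound C \<alpha> f \<longleftrightarrow>
     0 \<le> C \<and> (\<forall>x\<in>{0..1}. \<forall>y\<in>{0..1}. \<bar>f x - f y\<bar> \<le> C * \<bar>x - y\<bar> powr \<alpha>)"

lemma hoelder_space_iff_bound: "f \<in> hoelder_space \<alpha> \<longleftrightarrow> (\<exists>C. hoelder_bound C \<alpha> f)"
proof
  assume "f \<in> hoelder_space \<alpha>"
  then obtain C where C: "\<forall>x\<in>{0..1}. \<forall>y\<in>{0..1}. \<bar>f x - f y\<bar> \<le> C * \<bar>x - y\<bar> powr \<alpha>"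
    by (auto simp: hoelder_space_def)
  have "hoelder_bound \<bar>C\<bar> \<alpha> f"
    unfolding hoelder_bound_def
  proof (intro conjI ballI)
    fix x y :: real assume "x \<in> {0..1}" "y \<in> {0..1}"
    with C have "\<bar>f x - f y\<bar> \<le> C * \<bar>x - y\<bar> powr \<alpha>" by blast
    also have "\<dots> \<le> \<bar>C\<bar> * \<bar>x - y\<bar> powr \<alpha>" by (intro mult_right_mono) auto
    finally show "\<bar>f x - f y\<bar> \<le> \<bar>C\<bar> * \<bar>x - y\<bar> powr \<alpha>" .
  qed simp
  then show "\<exists>C. hoelder_bound C \<alpha> f" by blast
qed (auto simp: hoelder_space_def hoelder_bound_def)

lemma hoelder_bound_apply:
  "hoelder_bound C \<alpha> f \<Longrightarrow> x \<in> {0..1} \<Longrightarrow> y \<in> {0..1} \<Longrightarrow> \<bar>f x - f y\<bar> \<le> C * \<bar>x - y\<bar> powr \<alpha>"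
  by (simp add: hoelder_bound_def)

lemma powr_half_power: "(1 / 2 ^ n) powr a = (2 powr (- a)) ^ n" for a :: real
proof -
  have "(1 / 2 ^ n) = (2::real) powr (- real n)"
    by (simp add: powr_minus powr_realpow divide_inverse)
  moreover have "(2 powr (- a)) ^ n = (2 powr (- a)) powr real n"
    by (simp add: powr_realpow)
  ultimately show ?thesis by (simp add: powr_powr mult.commute)
qed

lemma continuous_on_unit_interval_bounded:
  fixes f :: "real \<Rightarrow> real"
  assumes "continuous_on {0..1} f"
  obtains B where "\<And>y. y \<in> {0..1} \<Longrightarrow> \<bar>f y\<bar> \<le> B"
proof -
  have "bounded (f ` {0..1})"
    using assms by (intro compact_imp_bounded compact_continuous_image) auto
  then obtain B where "\<forall>z\<in>f ` {0..1}. norm z \<le> B" unfolding bounded_iff by blast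
  then show thesis by (intro that[of B]) simp
qed

lemma hoelder_boundD:
  assumes "hoelder_bound C \<alpha> f" "0 \<le> \<alpha>" "x \<in> {0..1}" "y \<in> {0..1}" "\<bar>x - y\<bar> \<le> 1 / 2 ^ n"
  shows "\<bar>f x - f y\<bar> \<le> C * (2 powr (- \<alpha>)) ^ n"
proof -
  have "\<bar>f x - f y\<bar> \<le> C * \<bar>x - y\<bar> powr \<alpha>" using assms by (auto simp: hoelder_bound_def)
  also have "\<dots> \<le> C * (1 / 2 ^ n) powr \<alpha>"
    using assms by (intro mult_left_mono powr_mono2) (auto simp: hoelder_bound_def)
  finally show ?thesis by (simp only: powr_half_power)
qed

lemma hoelder_continuous_on:
  assumes "f \<in> hoelder_space \<alpha>" "0 < \<alpha>"
  shows "continuous_on {0..1} f"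
proof -
  obtain C where C: "hoelder_bound C \<alpha> f" using assms hoelder_space_iff_bound by blast
  show ?thesis unfolding continuous_on_def
  proof (intro ballI)
    fix x :: real assume x: "x \<in> {0..1}"
    have "((\<lambda>y. C * \<bar>y - x\<bar> powr \<alpha>) \<longlongrightarrow> C * \<bar>x - x\<bar> powr \<alpha>) (at x within {0..1})"
      using assms by (intro tendsto_intros tendsto_powr') auto
    then have "((\<lambda>y. C * \<bar>y - x\<bar> powr \<alpha>) \<longlongrightarrow> 0) (at x within {0..1})" by simp
    then have "((\<lambda>y. f y - f x) \<longlongrightarrow> 0) (at x within {0..1})"
    proof (rule Lim_null_comparison[rotated])
      show "\<forall>\<^sub>F y in at x within {0..1}. norm (f y - f x) \<le> C * \<bar>y - x\<bar> powr \<alpha>"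
        using C x by (auto simp: eventually_at_filter hoelder_bound_def)
    qed
    then show "(f \<longlongrightarrow> f x) (at x within {0..1})" by (simp add: LIM_zero_iff)
  qed
qed

lemma dyadic_pt_Suc_diff: "dyadic_pt n (Suc k) - dyadic_pt n k = 1 / 2 ^ n"
  by (simp add: dyadic_pt_def field_simps)

lemma hoelder_incr_le:
  assumes "hoelder_bound C \<alpha> f" "0 \<le> \<alpha>" "k < 2 ^ n"
  shows "\<bar>incr f n k\<bar> \<le> C * (2 powr (- \<alpha>)) ^ n"
  using assms by (intro hoelder_boundD dyadic_pt_in) (auto simp: dyadic_pt_Suc_diff)

lemma hoelder_dyadic_floor_le:
  assumes "hoelder_bound C \<alpha> f" "0 \<le> \<alpha>" "x \<in> {0..1}"
  shows "\<bar>f x - f (dyadic_floor n x)\<bar> \<le> C * (2 powr (- \<alpha>)) ^ n"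
  using assms dyadic_floor_bounds[of x n] by (intro hoelder_boundD) auto

lemma hoelder_dyadic_floor_Suc_le:
  assumes "hoelder_bound C \<alpha> f" "0 \<le> \<alpha>" "x \<in> {0..1}"
  shows "\<bar>f (dyadic_floor (Suc n) x) - f (dyadic_floor n x)\<bar> \<le> C * (2 powr (- \<alpha>)) ^ Suc n"
  using assms by (intro incr_dyadic_floor_Suc_le hoelder_incr_le) auto

lemma hoelder_sewing_term_le:
  assumes "hoelder_bound C \<alpha> f" "0 \<le> \<alpha>" "hoelder_bound D \<beta> g" "0 \<le> \<beta>" "k < 2 ^ n"
  shows "\<bar>sewing_term f g n k\<bar> \<le> C * D * (2 powr (- (\<alpha> + \<beta>))) ^ Suc n"
proof -
  have "\<bar>sewing_term f g n k\<bar> \<le> (C * (2 powr (- \<alpha>)) ^ Suc n) * (D * (2 powr (- \<beta>)) ^ Suc n)"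
    unfolding abs_mult using assms
    by (intro mult_mono hoelder_incr_le) (auto simp: hoelder_bound_def)
  also have "\<dots> = C * D * (2 powr (- (\<alpha> + \<beta>))) ^ Suc n"
    by (simp add: powr_add[symmetric] power_mult_distrib[symmetric] algebra_simps)
  finally show ?thesis .
qed

definition dyadic_limit :: "(real \<Rightarrow> real) \<Rightarrow> (real \<Rightarrow> real) \<Rightarrow> real \<Rightarrow> real" where
  "dyadic_limit f g x = lim (left_sum f g x)"

lemma convergent_if_summable_diff:
  fixes a :: "nat \<Rightarrow> real"
  assumes "summable (\<lambda>n. a (Suc n) - a n)"
  shows "convergent a"
proof -
  have "(\<lambda>n. (\<Sum>k<n. a (Suc k) - a k) + a 0) \<longlonglongrightarrow> (\<Sum>n. a (Suc n) - a n) + a 0"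
    by (intro tendsto_intros summable_LIMSEQ assms)
  then show ?thesis by (auto simp: sum_lessThan_telescope convergent_def)
qed

lemma two_powr_less_half: "1 < a \<Longrightarrow> 2 * 2 powr (- a) < (1::real)"
  using powr_less_mono[of "-a" "-1" 2] by (simp add: powr_minus)

text \<open>
  Refining at level \<open>n\<close> adds at most \<open>2 ^ n\<close> sewing terms of size \<open>2 powr (- n * (\<alpha> + \<beta>))\<close>, which is
  summable in \<open>n\<close> because \<open>\<alpha> + \<beta> > 1\<close>, and a boundary term of size \<open>2 powr (- n * \<beta>)\<close>.
\<close>
lemma hoelder_left_sum_tendsto:
  assumes f: "hoelder_bound C \<alpha> f" "0 < \<alpha>" and g: "hoelder_bound D \<beta> g" "0 < \<beta>"
    and ab: "1 < \<alpha> + \<beta>" and x: "x \<in> {0..1}"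
  shows "left_sum f g x \<longlonglongrightarrow> dyadic_limit f g x"
proof -
  define \<gamma> where "\<gamma> = (2::real) powr (- (\<alpha> + \<beta>))"
  define \<rho> where "\<rho> = (2::real) powr (- \<beta>)"
  have \<gamma>: "0 < \<gamma>" "2 * \<gamma> < 1" using two_powr_less_half[OF ab] by (auto simp: \<gamma>_def)
  have \<rho>: "0 < \<rho>" "\<rho> < 1" using g powr_less_mono[of "-\<beta>" 0 2] by (auto simp: \<rho>_def)
  have CD: "0 \<le> C" "0 \<le> D" using f g by (auto simp: hoelder_bound_def)
  have "continuous_on {0..1} f" using f hoelder_continuous_on hoelder_space_iff_bound by blast
  then obtain B where B: "\<And>y. y \<in> {0..1} \<Longrightarrow> \<bar>f y\<bar> \<le> B"
    by (rule continuous_on_unit_interval_bounded) blast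
  have "summable (\<lambda>n. left_sum f g x (Suc n) - left_sum f g x n)"
  proof (rule summable_comparison_test'[where g="\<lambda>n. C * D * (2 * \<gamma>) ^ n + (B * D) * \<rho> ^ n" and N=0])
    show "summable (\<lambda>n. C * D * (2 * \<gamma>) ^ n + (B * D) * \<rho> ^ n)"
      using \<gamma> \<rho> by (intro summable_add summable_mult summable_geometric) auto
    fix n :: nat
    have x0: "0 \<le> x" "x \<le> 1" using x by auto
    have "\<bar>\<Sum>k<dyadic_index n x. sewing_term f g n k\<bar> \<le> (\<Sum>k<dyadic_index n x. C * D * \<gamma> ^ Suc n)"
    proof (rule order_trans[OF sum_abs], rule sum_mono)
      fix k assume "k \<in> {..<dyadic_index n x}"
      then have "k < 2 ^ n" using dyadic_index_le[OF x0, of n] by simp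
      then show "\<bar>sewing_term f g n k\<bar> \<le> C * D * \<gamma> ^ Suc n"
        unfolding \<gamma>_def using f g by (intro hoelder_sewing_term_le) auto
    qed
    also have "\<dots> \<le> 2 ^ n * (C * D * \<gamma> ^ Suc n)"
    proof -
      have "real (dyadic_index n x) \<le> 2 ^ n"
        using dyadic_index_le[OF x0, of n] by simp
      then show ?thesis using \<gamma> CD by (simp add: mult_right_mono)
    qed
    also have "\<dots> \<le> 2 ^ n * (C * D * \<gamma> ^ n)"
      using \<gamma> CD by (intro mult_left_mono) (auto simp: mult_left_le_one_le)
    finally have 1: "\<bar>\<Sum>k<dyadic_index n x. sewing_term f g n k\<bar> \<le> C * D * (2 * \<gamma>) ^ n"
      by (simp add: power_mult_distrib algebra_simps)
    have "dyadic_floor n x \<in> {0..1}" using dyadic_floor_bounds[OF x0(1), of n] x0 by auto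
    then have "\<bar>f (dyadic_floor n x)\<bar> \<le> B" by (rule B)
    moreover have "\<bar>g (dyadic_floor (Suc n) x) - g (dyadic_floor n x)\<bar> \<le> D * \<rho> ^ Suc n"
      unfolding \<rho>_def using g x by (intro hoelder_dyadic_floor_Suc_le) auto
    moreover have "D * \<rho> ^ Suc n \<le> D * \<rho> ^ n"
      using \<rho> CD by (intro mult_left_mono) (auto simp: mult_left_le_one_le)
    ultimately have 2: "\<bar>f (dyadic_floor n x) * (g (dyadic_floor (Suc n) x) - g (dyadic_floor n x))\<bar>
        \<le> B * (D * \<rho> ^ n)"
      unfolding abs_mult by (intro mult_mono) auto
    show "norm (left_sum f g x (Suc n) - left_sum f g x n) \<le> C * D * (2 * \<gamma>) ^ n + (B * D) * \<rho> ^ n"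
      unfolding left_sum_refine[OF x0(1)] real_norm_def using 1 2 by (simp add: mult.assoc)
  qed
  then have "convergent (left_sum f g x)" by (rule convergent_if_summable_diff)
  then show ?thesis by (simp add: dyadic_limit_def convergent_LIMSEQ_iff)
qed

lemma dyadic_limit_0 [simp]: "dyadic_limit f g 0 = 0"
proof -
  have "left_sum f g 0 = (\<lambda>_. 0)" by (auto simp: left_sum_def)
  then show ?thesis unfolding dyadic_limit_def by (intro limI) simp
qed

text \<open>
  Only the grid intervals between \<open>s\<close> and \<open>t\<close> carry sewing terms, and at level \<open>j \<ge> N\<close> there are at most
  \<open>2 * 2 ^ (j - N)\<close> of them. This locality gives the factor \<open>\<gamma> ^ N\<close>.
\<close>
lemma hoelder_Young_Loeve_dyadic:
  assumes f: "hoelder_bound C \<alpha> f" "0 < \<alpha>" and g: "hoelder_bound D \<beta> g" "0 < \<beta>"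
    and ab: "1 < \<alpha> + \<beta>"
    and st: "0 \<le> s" "s \<le> \<xi>" "\<xi> \<le> t" "t \<le> 1" "t - s \<le> 1 / 2 ^ N"
  defines "\<gamma> \<equiv> 2 powr (- (\<alpha> + \<beta>))"
  shows "\<bar>dyadic_limit f g t - dyadic_limit f g s - f \<xi> * (g t - g s)\<bar>
    \<le> (4 * C * D / (1 - 2 * \<gamma>) + 4 * C * D) * \<gamma> ^ N"
proof -
  define \<mu> where "\<mu> = (2::real) powr (- \<alpha>)"
  define \<rho> where "\<rho> = (2::real) powr (- \<beta>)"
  have \<gamma>: "0 < \<gamma>" "2 * \<gamma> < 1" using two_powr_less_half[OF ab] by (auto simp: \<gamma>_def)
  have pos: "0 < \<mu>" "0 < \<rho>" by (simp_all add: \<mu>_def \<rho>_def)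
  have \<rho>1: "\<rho> \<le> 1" using g powr_mono[of "-\<beta>" 0 2] by (simp add: \<rho>_def)
  have \<mu>\<rho>: "\<mu> ^ j * \<rho> ^ j = \<gamma> ^ j" for j
    by (simp add: \<mu>_def \<rho>_def \<gamma>_def powr_add[symmetric] power_mult_distrib[symmetric])
  have CD: "0 \<le> C" "0 \<le> D" using f g by (auto simp: hoelder_bound_def)
  have st': "0 \<le> s" "s \<le> t" "t \<le> 1" "t - s \<le> 1 / 2 ^ N" using st by auto
  have mem: "s \<in> {0..1}" "t \<in> {0..1}" "\<xi> \<in> {0..1}" using st by auto
  have fa: "0 \<le> \<alpha>" "0 \<le> \<beta>" using f g by auto
  have boundary: "\<bar>f x - f (dyadic_floor j x)\<bar> * \<bar>g (dyadic_floor (Suc j) x) - g (dyadic_floor j x)\<bar>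
      \<le> C * D * \<gamma> ^ j" if "x \<in> {0..1}" for x j
  proof -
    have "\<bar>f x - f (dyadic_floor j x)\<bar> * \<bar>g (dyadic_floor (Suc j) x) - g (dyadic_floor j x)\<bar>
      \<le> (C * \<mu> ^ j) * (D * \<rho> ^ Suc j)"
      unfolding \<mu>_def \<rho>_def using CD
      by (intro mult_mono hoelder_dyadic_floor_le[OF f(1) fa(1) that]
          hoelder_dyadic_floor_Suc_le[OF g(1) fa(2) that]) auto
    also have "\<dots> = (C * D * \<gamma> ^ j) * \<rho>"
      by (simp add: \<mu>\<rho>[symmetric])
    also have "\<dots> \<le> (C * D * \<gamma> ^ j) * 1"
      using CD \<gamma> \<rho>1 by (intro mult_left_mono) auto
    finally show ?thesis by simp
  qed
  define E where "E = 4 * C * D / (1 - 2 * \<gamma>) * \<gamma> ^ N"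
  define e where "e j = (\<Sum>k\<in>{dyadic_index j s..<dyadic_index j t}. \<bar>sewing_term f g j k\<bar>)
         + \<bar>f t - f (dyadic_floor j t)\<bar> * \<bar>g (dyadic_floor (Suc j) t) - g (dyadic_floor j t)\<bar>
         + \<bar>f s - f (dyadic_floor j s)\<bar> * \<bar>g (dyadic_floor (Suc j) s) - g (dyadic_floor j s)\<bar>" for j
  have e: "e j \<le> 4 * C * D * \<gamma> ^ N * (2 * \<gamma>) ^ (j - N)" if "N \<le> j" for j
  proof -
    have pw: "(2::real) ^ j = 2 ^ N * 2 ^ (j - N)" "\<gamma> ^ j = \<gamma> ^ N * \<gamma> ^ (j - N)"
      using that by (simp_all add: power_add[symmetric])
    have "real (dyadic_index j t - dyadic_index j s) \<le> 2 ^ j * (t - s) + 1"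
      using dyadic_index_bounds[of s j] dyadic_index_bounds[of t j] dyadic_index_mono[OF st'(2), of j] st'
      by (simp add: of_nat_diff right_diff_distrib)
    also have "2 ^ j * (t - s) \<le> 2 ^ (j - N)"
    proof -
      have "2 ^ N * (t - s) \<le> 1" using st'(4) by (simp add: field_simps)
      then have "2 ^ (j - N) * (2 ^ N * (t - s)) \<le> 2 ^ (j - N) * 1" by (intro mult_left_mono) auto
      then show ?thesis unfolding pw(1) by (simp add: mult_ac)
    qed
    also have "(1::real) \<le> 2 ^ (j - N)" by simp
    finally have cnt: "real (dyadic_index j t - dyadic_index j s) \<le> 2 * 2 ^ (j - N)" by simp
    have "(\<Sum>k\<in>{dyadic_index j s..<dyadic_index j t}. \<bar>sewing_term f g j k\<bar>)
        \<le> (\<Sum>k\<in>{dyadic_index j s..<dyadic_index j t}. C * D * \<gamma> ^ j)"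
    proof (rule sum_mono)
      fix k assume "k \<in> {dyadic_index j s..<dyadic_index j t}"
      then have "k < 2 ^ j" using dyadic_index_le[of t j] st' by simp
      then have "\<bar>sewing_term f g j k\<bar> \<le> C * D * \<gamma> ^ Suc j"
        unfolding \<gamma>_def using f(1) g(1) fa by (intro hoelder_sewing_term_le) auto
      also have "\<dots> \<le> C * D * \<gamma> ^ j"
        using \<gamma> CD by (intro mult_left_mono) (auto simp: mult_left_le_one_le)
      finally show "\<bar>sewing_term f g j k\<bar> \<le> C * D * \<gamma> ^ j" .
    qed
    also have "\<dots> = real (dyadic_index j t - dyadic_index j s) * (C * D * \<gamma> ^ j)" by simp
    also have "\<dots> \<le> 2 * 2 ^ (j - N) * (C * D * \<gamma> ^ j)"
      using cnt CD \<gamma> by (intro mult_right_mono) auto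
    finally have "e j \<le> 2 * 2 ^ (j - N) * (C * D * \<gamma> ^ j) + C * D * \<gamma> ^ j + C * D * \<gamma> ^ j"
      unfolding e_def using boundary[OF mem(1), of j] boundary[OF mem(2), of j] by linarith
    moreover have "1 * (C * D * \<gamma> ^ j) \<le> 2 ^ (j - N) * (C * D * \<gamma> ^ j)"
      using CD \<gamma> by (intro mult_right_mono) auto
    ultimately have "e j \<le> 4 * (2 ^ (j - N) * (C * D * \<gamma> ^ j))" by linarith
    then show ?thesis by (simp add: pw(2) power_mult_distrib algebra_simps)
  qed
  have E: "(\<Sum>j\<in>{N..<n}. e j) \<le> E" for n
  proof (cases "N \<le> n")
    case True
    have "(\<Sum>j\<in>{N..<n}. e j) \<le> (\<Sum>j\<in>{N..<n}. 4 * C * D * \<gamma> ^ N * (2 * \<gamma>) ^ (j - N))"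
      using e by (intro sum_mono) auto
    also have "\<dots> = 4 * C * D * \<gamma> ^ N * (\<Sum>i<n - N. (2 * \<gamma>) ^ i)"
      unfolding sum_distrib_left[symmetric]
      using sum.shift_bounds_nat_ivl[of "\<lambda>j. (2 * \<gamma>) ^ (j - N)" 0 N "n - N"] True
      by (simp add: lessThan_atLeast0)
    also have "\<dots> \<le> 4 * C * D * \<gamma> ^ N * (\<Sum>i. (2 * \<gamma>) ^ i)"
      using \<gamma> CD by (intro mult_left_mono sum_le_suminf summable_geometric) auto
    also have "(\<Sum>i. (2 * \<gamma>) ^ i) = 1 / (1 - 2 * \<gamma>)" using \<gamma> by (intro suminf_geometric) simp
    also have "4 * C * D * \<gamma> ^ N * (1 / (1 - 2 * \<gamma>)) = E" by (simp add: E_def)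
    finally show ?thesis .
  next
    case False
    then show ?thesis using CD \<gamma> by (simp add: E_def)
  qed
  have g_cont: "continuous_on {0..1} g" using g hoelder_continuous_on hoelder_space_iff_bound by blast
  note basic = Young_Loeve_basic[OF st' g_cont hoelder_left_sum_tendsto[OF f g ab mem(2)]
      hoelder_left_sum_tendsto[OF f g ab mem(1)] E[unfolded e_def], of "f \<xi>"]
  have near: "\<bar>f x - f \<xi>\<bar> \<le> C * \<mu> ^ N" if "x = s \<or> x = t" for x
    unfolding \<mu>_def using that st mem by (intro hoelder_boundD[OF f(1) fa(1)]) auto
  have gfl: "\<bar>g x - g (dyadic_floor N x)\<bar> \<le> D * \<rho> ^ N" if "x \<in> {0..1}" for x
    unfolding \<rho>_def by (rule hoelder_dyadic_floor_le[OF g(1) fa(2) that])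
  have "\<bar>f s - f (dyadic_floor N s)\<bar> \<le> C * \<mu> ^ N"
    unfolding \<mu>_def by (rule hoelder_dyadic_floor_le[OF f(1) fa(1) mem(1)])
  then have "\<bar>f (dyadic_floor N s) - f \<xi>\<bar> \<le> 2 * (C * \<mu> ^ N)"
    using near[of s] by linarith
  moreover have "\<bar>g (dyadic_floor N t) - g (dyadic_floor N s)\<bar> \<le> D * \<rho> ^ N"
    unfolding \<rho>_def by (intro incr_dyadic_floor_le[OF st'] hoelder_incr_le[OF g(1) fa(2)])
  ultimately have "\<bar>f (dyadic_floor N s) - f \<xi>\<bar> * \<bar>g (dyadic_floor N t) - g (dyadic_floor N s)\<bar>
      \<le> 2 * (C * \<mu> ^ N) * (D * \<rho> ^ N)"
    using CD pos by (intro mult_mono) auto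
  moreover have "\<bar>f s - f \<xi>\<bar> * \<bar>g s - g (dyadic_floor N s)\<bar> \<le> (C * \<mu> ^ N) * (D * \<rho> ^ N)"
    "\<bar>f t - f \<xi>\<bar> * \<bar>g t - g (dyadic_floor N t)\<bar> \<le> (C * \<mu> ^ N) * (D * \<rho> ^ N)"
    using CD pos mem by (auto intro!: mult_mono near gfl)
  moreover have "(C * \<mu> ^ N) * (D * \<rho> ^ N) = C * D * \<gamma> ^ N"
    "2 * (C * \<mu> ^ N) * (D * \<rho> ^ N) = 2 * (C * D * \<gamma> ^ N)"
    by (simp_all add: \<mu>\<rho>[symmetric])
  ultimately have "\<bar>dyadic_limit f g t - dyadic_limit f g s - f \<xi> * (g t - g s)\<bar>
      \<le> E + 4 * (C * D * \<gamma> ^ N)"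
    using basic by linarith
  then show ?thesis by (simp add: E_def algebra_simps)
qed

lemma dyadic_scale_exists:
  fixes d :: real
  assumes "0 < d" "d \<le> 1"
  obtains N where "1 / 2 ^ N < 2 * d" "d \<le> 1 / 2 ^ N"
proof -
  have ex: "\<exists>n. (1 / 2) ^ n < d" using assms by (intro real_arch_pow_inv) auto
  define m where "m = (LEAST n. (1 / 2) ^ n < d)"
  have m: "(1 / 2) ^ m < d" unfolding m_def by (rule LeastI_ex[OF ex])
  then obtain N where N: "m = Suc N" using assms by (cases m) auto
  have "\<not> (1 / 2) ^ N < d" using not_less_Least[of N "\<lambda>n. (1 / 2) ^ n < d"] N by (simp add: m_def)
  with m N show thesis by (intro that[of N]) (auto simp: power_divide)
qed

text \<open>
  The dyadic scale just above \<open>t - s\<close> is less than \<open>2 * (t - s)\<close>, which costs only a constant factor.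
\<close>
lemma hoelder_Young_Loeve:
  assumes f: "hoelder_bound C \<alpha> f" "0 < \<alpha>" and g: "hoelder_bound D \<beta> g" "0 < \<beta>"
    and ab: "1 < \<alpha> + \<beta>"
  obtains K where "0 \<le> K"
    "\<And>s \<xi> t. 0 \<le> s \<Longrightarrow> s \<le> \<xi> \<Longrightarrow> \<xi> \<le> t \<Longrightarrow> t \<le> 1 \<Longrightarrow>
       \<bar>dyadic_limit f g t - dyadic_limit f g s - f \<xi> * (g t - g s)\<bar> \<le> K * (t - s) powr (\<alpha> + \<beta>)"
proof -
  define \<gamma> where "\<gamma> = (2::real) powr (- (\<alpha> + \<beta>))"
  define L where "L = 4 * C * D / (1 - 2 * \<gamma>) + 4 * C * D"
  have \<gamma>: "0 < \<gamma>" "2 * \<gamma> < 1" using two_powr_less_half[OF ab] by (auto simp: \<gamma>_def)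
  have L: "0 \<le> L" using f g \<gamma> by (auto simp: L_def hoelder_bound_def)
  show thesis
  proof (rule that[of "L * 2 powr (\<alpha> + \<beta>)"])
    show "0 \<le> L * 2 powr (\<alpha> + \<beta>)" using L by simp
    fix s \<xi> t :: real assume st: "0 \<le> s" "s \<le> \<xi>" "\<xi> \<le> t" "t \<le> 1"
    show "\<bar>dyadic_limit f g t - dyadic_limit f g s - f \<xi> * (g t - g s)\<bar>
        \<le> L * 2 powr (\<alpha> + \<beta>) * (t - s) powr (\<alpha> + \<beta>)"
    proof (cases "s = t")
      case False
      then have d: "0 < t - s" "t - s \<le> 1" using st by auto
      obtain N where N: "1 / 2 ^ N < 2 * (t - s)" "t - s \<le> 1 / 2 ^ N"
        using dyadic_scale_exists[OF d] by blast
      have "\<bar>dyadic_limit f g t - dyadic_limit f g s - f \<xi> * (g t - g s)\<bar> \<le> L * \<gamma> ^ N"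
        unfolding L_def \<gamma>_def by (rule hoelder_Young_Loeve_dyadic[OF f g ab st N(2)])
      also have "\<gamma> ^ N = (1 / 2 ^ N) powr (\<alpha> + \<beta>)" unfolding \<gamma>_def by (rule powr_half_power[symmetric])
      also have "L * (1 / 2 ^ N) powr (\<alpha> + \<beta>) \<le> L * (2 * (t - s)) powr (\<alpha> + \<beta>)"
        using N ab L by (intro mult_left_mono powr_mono2) auto
      also have "(2 * (t - s)) powr (\<alpha> + \<beta>) = 2 powr (\<alpha> + \<beta>) * (t - s) powr (\<alpha> + \<beta>)"
        using d by (subst powr_mult) auto
      finally show ?thesis by (simp add: mult.assoc)
    qed simp
  qed
qed

section \<open>Young integrals\<close>

text \<open>
  Since \<open>\<eta> > 1\<close>, the local errors over a partition of mesh \<open>\<delta>\<close> add up to at most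
  \<open>K * \<delta> powr (\<eta> - 1) * (b - a)\<close>.
\<close>
lemma has_young_integralI:
  fixes I :: "real \<Rightarrow> real"
  assumes "0 \<le> K" "1 < \<eta>" "{a..b} \<subseteq> {0..1}"
    and local: "\<And>s \<xi> t. 0 \<le> s \<Longrightarrow> s \<le> \<xi> \<Longrightarrow> \<xi> \<le> t \<Longrightarrow> t \<le> 1 \<Longrightarrow>
       \<bar>I t - I s - f \<xi> * (g t - g s)\<bar> \<le> K * (t - s) powr \<eta>"
  shows "has_young_integral f g a b (I b - I a)"
  unfolding has_young_integral_def
proof (intro allI impI)
  fix \<epsilon> :: real assume "0 < \<epsilon>"
  \<comment> \<open>Chosen so that \<open>K * \<delta> powr (\<eta> - 1) = K * \<epsilon> / (K + 1) < \<epsilon>\<close>.\<close>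
  define \<delta> where "\<delta> = (\<epsilon> / (K + 1)) powr (1 / (\<eta> - 1))"
  have \<delta>: "0 < \<delta>" "\<delta> powr (\<eta> - 1) = \<epsilon> / (K + 1)"
    using \<open>0 < \<epsilon>\<close> assms(1,2) by (simp_all add: \<delta>_def powr_powr)
  show "\<exists>\<delta>>0. \<forall>(n::nat) s \<xi>. s 0 = a \<and> s n = b \<and>
        (\<forall>i<n. s i < s (Suc i) \<and> s (Suc i) - s i < \<delta> \<and> \<xi> i \<in> {s i..s (Suc i)})
        \<longrightarrow> \<bar>(\<Sum>i<n. f (\<xi> i) * (g (s (Suc i)) - g (s i))) - (I b - I a)\<bar> < \<epsilon>"
  proof (intro exI[of _ \<delta>] conjI allI impI \<delta>(1))
    fix n :: nat and s \<xi> :: "nat \<Rightarrow> real"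
    assume *: "s 0 = a \<and> s n = b \<and>
        (\<forall>i<n. s i < s (Suc i) \<and> s (Suc i) - s i < \<delta> \<and> \<xi> i \<in> {s i..s (Suc i)})"
    have mono: "s i \<le> s j" if "i \<le> j" "j \<le> n" for i j
      using that
    proof (induction j rule: dec_induct)
      case (step j)
      then have "s j < s (Suc j)" using * by simp
      then show ?case using step by simp
    qed simp
    have ab: "a \<le> b" using * mono[of 0 n] by simp
    then have ab01: "0 \<le> a" "b \<le> 1" using assms(3) by auto
    have "\<bar>I (s (Suc i)) - I (s i) - f (\<xi> i) * (g (s (Suc i)) - g (s i))\<bar>
        \<le> K * (\<epsilon> / (K + 1)) * (s (Suc i) - s i)" if "i < n" for i
    proof -
      have i: "s i < s (Suc i)" "s (Suc i) - s i < \<delta>" "s i \<le> \<xi> i" "\<xi> i \<le> s (Suc i)"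
        using * that by auto
      have bd: "0 \<le> s i" "s (Suc i) \<le> 1"
        using mono[of 0 i] mono[of "Suc i" n] that ab01 * by auto
      have "\<bar>I (s (Suc i)) - I (s i) - f (\<xi> i) * (g (s (Suc i)) - g (s i))\<bar>
          \<le> K * (s (Suc i) - s i) powr \<eta>"
        by (intro local bd i)
      also have "(s (Suc i) - s i) powr \<eta> = (s (Suc i) - s i) * (s (Suc i) - s i) powr (\<eta> - 1)"
        using i by (simp add: powr_mult_base)
      also have "K * ((s (Suc i) - s i) * (s (Suc i) - s i) powr (\<eta> - 1))
          \<le> K * ((s (Suc i) - s i) * \<delta> powr (\<eta> - 1))"
        using i assms(1,2) by (intro mult_left_mono powr_mono2) auto
      finally show ?thesis by (simp add: \<delta>(2) mult_ac)
    qed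
    then have "(\<Sum>i<n. \<bar>I (s (Suc i)) - I (s i) - f (\<xi> i) * (g (s (Suc i)) - g (s i))\<bar>)
        \<le> (\<Sum>i<n. K * (\<epsilon> / (K + 1)) * (s (Suc i) - s i))"
      by (intro sum_mono) simp
    also have "\<dots> = K * (\<epsilon> / (K + 1)) * (b - a)"
      using * by (simp only: sum_distrib_left[symmetric] sum_lessThan_telescope)
    also have "\<dots> \<le> K * (\<epsilon> / (K + 1)) * 1"
      using ab01 assms(1) \<open>0 < \<epsilon>\<close> by (intro mult_left_mono) auto
    also have "\<dots> < \<epsilon>" using assms(1) \<open>0 < \<epsilon>\<close> by (simp add: field_simps)
    finally have "\<bar>\<Sum>i<n. I (s (Suc i)) - I (s i) - f (\<xi> i) * (g (s (Suc i)) - g (s i))\<bar> < \<epsilon>"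
      using sum_abs[of "\<lambda>i. I (s (Suc i)) - I (s i) - f (\<xi> i) * (g (s (Suc i)) - g (s i))" "{..<n}"]
      by linarith
    moreover have "(\<Sum>i<n. I (s (Suc i)) - I (s i) - f (\<xi> i) * (g (s (Suc i)) - g (s i)))
        = (I b - I a) - (\<Sum>i<n. f (\<xi> i) * (g (s (Suc i)) - g (s i)))"
      unfolding sum_subtractf[of "\<lambda>i. I (s (Suc i)) - I (s i)"] using *
      by (simp add: sum_lessThan_telescope[of "\<lambda>i. I (s i)"])
    ultimately show "\<bar>(\<Sum>i<n. f (\<xi> i) * (g (s (Suc i)) - g (s i))) - (I b - I a)\<bar> < \<epsilon>"
      by (simp add: abs_minus_commute)
  qed
qed

lemma has_young_integralE:
  assumes "has_young_integral f g a b I" "0 < \<epsilon>"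
  obtains \<delta> where "0 < \<delta>" "\<forall>(n::nat) s \<xi>. s 0 = a \<and> s n = b \<and>
        (\<forall>i<n. s i < s (Suc i) \<and> s (Suc i) - s i < \<delta> \<and> \<xi> i \<in> {s i..s (Suc i)})
        \<longrightarrow> \<bar>(\<Sum>i<n. f (\<xi> i) * (g (s (Suc i)) - g (s i))) - I\<bar> < \<epsilon>"
proof -
  note assms(1)[unfolded has_young_integral_def, THEN spec, THEN mp, OF assms(2)]
  then show thesis by (elim exE conjE) (rule that)
qed

text \<open>
  Right tags for \<open>f dg\<close> and left tags for \<open>g df\<close> on one common fine partition make the sum of the two
  Riemann sums telescope to the increment of \<open>f * g\<close>.
\<close>
lemma young_integral_by_parts:
  assumes A: "has_young_integral f g a b A" and B: "has_young_integral g f a b B" and "a \<le> b"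
  shows "A + B = f b * g b - f a * g a"
proof -
  have "\<bar>A + B - (f b * g b - f a * g a)\<bar> \<le> 0 + \<epsilon>" if "0 < \<epsilon>" for \<epsilon>
  proof -
    obtain \<delta>1 where \<delta>1: "0 < \<delta>1" "\<forall>(n::nat) s \<xi>. s 0 = a \<and> s n = b \<and>
        (\<forall>i<n. s i < s (Suc i) \<and> s (Suc i) - s i < \<delta>1 \<and> \<xi> i \<in> {s i..s (Suc i)})
        \<longrightarrow> \<bar>(\<Sum>i<n. f (\<xi> i) * (g (s (Suc i)) - g (s i))) - A\<bar> < \<epsilon> / 2"
      by (rule has_young_integralE[OF A half_gt_zero[OF \<open>0 < \<epsilon>\<close>]])
    obtain \<delta>2 where \<delta>2: "0 < \<delta>2" "\<forall>(n::nat) s \<xi>. s 0 = a \<and> s n = b \<and>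
        (\<forall>i<n. s i < s (Suc i) \<and> s (Suc i) - s i < \<delta>2 \<and> \<xi> i \<in> {s i..s (Suc i)})
        \<longrightarrow> \<bar>(\<Sum>i<n. g (\<xi> i) * (f (s (Suc i)) - f (s i))) - B\<bar> < \<epsilon> / 2"
      by (rule has_young_integralE[OF B half_gt_zero[OF \<open>0 < \<epsilon>\<close>]])
    obtain n s where s: "s 0 = a" "s n = b"
      "\<And>i. i < n \<Longrightarrow> s i < s (Suc i) \<and> s (Suc i) - s i < min \<delta>1 \<delta>2"
    \<comment> \<open>Partitions are strictly increasing, so a degenerate interval has only the trivial one.\<close>
    proof (cases "a = b")
      case True
      then show ?thesis by (intro that[of "\<lambda>_. a" 0]) auto
    next
      case False
      then have "a < b" using \<open>a \<le> b\<close> by simp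
      obtain n where n: "(b - a) / min \<delta>1 \<delta>2 < real n" using reals_Archimedean2 by blast
      have "0 < (b - a) / min \<delta>1 \<delta>2" using \<open>a < b\<close> \<delta>1(1) \<delta>2(1) by simp
      then have "0 < real n" using n by linarith
      define s where "s i = a + (b - a) / real n * real i" for i
      have diff: "s (Suc i) - s i = (b - a) / real n" for i by (simp add: s_def distrib_left)
      have "(b - a) / real n < min \<delta>1 \<delta>2"
        using n \<open>0 < real n\<close> \<delta>1(1) \<delta>2(1)
        by (simp add: divide_less_eq mult.commute del: min_less_iff_conj)
      moreover have "0 < (b - a) / real n" using \<open>a < b\<close> \<open>0 < real n\<close> by simp
      moreover have "s 0 = a" "s n = b" using \<open>0 < real n\<close> by (simp_all add: s_def)
      moreover have "s i < s (Suc i)" if "0 < (b - a) / real n" for i using diff[of i] that by linarith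
      ultimately show ?thesis using diff by (intro that[of s n]) auto
    qed
    have "\<bar>(\<Sum>i<n. f (s (Suc i)) * (g (s (Suc i)) - g (s i))) - A\<bar> < \<epsilon> / 2"
      by (rule \<delta>1(2)[THEN spec[of _ n], THEN spec[of _ s], THEN spec[of _ "\<lambda>i. s (Suc i)"], THEN mp])
        (use s in \<open>auto intro: less_imp_le\<close>)
    moreover have "\<bar>(\<Sum>i<n. g (s i) * (f (s (Suc i)) - f (s i))) - B\<bar> < \<epsilon> / 2"
      by (rule \<delta>2(2)[THEN spec[of _ n], THEN spec[of _ s], THEN spec[of _ s], THEN mp])
        (use s in \<open>auto intro: less_imp_le\<close>)
    moreover have "(\<Sum>i<n. f (s (Suc i)) * (g (s (Suc i)) - g (s i)))
        + (\<Sum>i<n. g (s i) * (f (s (Suc i)) - f (s i))) = f b * g b - f a * g a"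
    proof -
      have "(\<Sum>i<n. f (s (Suc i)) * (g (s (Suc i)) - g (s i)))
        + (\<Sum>i<n. g (s i) * (f (s (Suc i)) - f (s i)))
        = (\<Sum>i<n. f (s (Suc i)) * g (s (Suc i)) - f (s i) * g (s i))"
        unfolding sum.distrib[symmetric] by (intro sum.cong) (auto simp: algebra_simps)
      also have "\<dots> = f b * g b - f a * g a"
        using s sum_lessThan_telescope[of "\<lambda>i. f (s i) * g (s i)" n] by simp
      finally show ?thesis .
    qed
    ultimately show ?thesis by linarith
  qed
  then have "\<bar>A + B - (f b * g b - f a * g a)\<bar> \<le> 0" by (rule field_le_epsilon)
  then show ?thesis by simp
qed

section \<open>The Faber--Schauder integral\<close>

lemma hoelder_dyadic_limit_continuous:
  assumes f: "hoelder_bound C \<alpha> f" "0 < \<alpha>" and g: "hoelder_bound D \<beta> g" "0 < \<beta>"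
    and ab: "1 < \<alpha> + \<beta>"
  shows "continuous_on {0..1} (dyadic_limit f g)"
proof -
  obtain K where K: "0 \<le> K"
    "\<And>s \<xi> t. 0 \<le> s \<Longrightarrow> s \<le> \<xi> \<Longrightarrow> \<xi> \<le> t \<Longrightarrow> t \<le> 1 \<Longrightarrow>
       \<bar>dyadic_limit f g t - dyadic_limit f g s - f \<xi> * (g t - g s)\<bar> \<le> K * (t - s) powr (\<alpha> + \<beta>)"
    using hoelder_Young_Loeve[OF f g ab] by blast
  have "continuous_on {0..1} f" using f hoelder_continuous_on hoelder_space_iff_bound by blast
  then obtain B where B: "\<And>y. y \<in> {0..1} \<Longrightarrow> \<bar>f y\<bar> \<le> B"
    by (rule continuous_on_unit_interval_bounded) blast
  have *: "\<bar>dyadic_limit f g t - dyadic_limit f g s\<bar> \<le> (B * D + K) * \<bar>t - s\<bar> powr \<beta>"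
    if st: "0 \<le> s" "s \<le> t" "t \<le> 1" for s t
  proof -
    have "\<bar>f s * (g t - g s)\<bar> \<le> B * (D * \<bar>t - s\<bar> powr \<beta>)"
      unfolding abs_mult using B[of s] st by (intro mult_mono hoelder_bound_apply[OF g(1)]) auto
    moreover have "K * (t - s) powr (\<alpha> + \<beta>) \<le> K * (t - s) powr \<beta>"
      using K(1) st f g by (intro mult_left_mono powr_mono') auto
    ultimately have "\<bar>dyadic_limit f g t - dyadic_limit f g s\<bar> \<le> B * (D * \<bar>t - s\<bar> powr \<beta>) + K * \<bar>t - s\<bar> powr \<beta>"
      using K(2)[of s s t] st by simp
    then show ?thesis by (simp add: algebra_simps)
  qed
  have "dyadic_limit f g \<in> hoelder_space \<beta>"
    unfolding hoelder_space_def
  proof (intro CollectI exI ballI)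
    fix x y :: real assume "x \<in> {0..1}" "y \<in> {0..1}"
    then show "\<bar>dyadic_limit f g x - dyadic_limit f g y\<bar> \<le> (B * D + K) * \<bar>x - y\<bar> powr \<beta>"
      using *[of x y] *[of y x] by (cases "x \<le> y") (auto simp: abs_minus_commute)
  qed
  then show ?thesis using g by (intro hoelder_continuous_on)
qed

lemma dyadic_floor_in_dyadics:
  assumes "x \<in> {0..1}"
  shows "dyadic_floor n x \<in> dyadics"
  using dyadic_index_le[of x n] assms unfolding dyadics_def dyadic_grid_def dyadic_floor_def
  by (intro UN_I[of n] imageI) auto

lemma dyadics_subset: "dyadics \<subseteq> {0..1}"
  using dyadic_pt_in by (auto simp: dyadics_def dyadic_grid_def)

text \<open>
  The limits at all real endpoints form one continuous extension; any other one agrees with it on the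
  dyadic points, hence everywhere on \<open>[0, 1]\<close> by density.
\<close>
lemma fs_integral_eq_dyadic_limit:
  assumes lim: "\<And>x. x \<in> {0..1} \<Longrightarrow> left_sum f g x \<longlonglongrightarrow> dyadic_limit f g x"
    and cont: "continuous_on {0..1} (dyadic_limit f g)"
  shows "fs_integrable f g" and "\<And>x. x \<in> {0..1} \<Longrightarrow> fs_integral f g x = dyadic_limit f g x"
proof -
  have shift: "(\<lambda>j. left_sum f g t (dyadic_level t + j)) \<longlonglongrightarrow> dyadic_limit f g t" if "t \<in> dyadics" for t
    using LIMSEQ_ignore_initial_segment[OF lim, of t "dyadic_level t"] that dyadics_subset
    by (auto simp: add.commute)
  have di: "dyadic_integral f g t = dyadic_limit f g t" if "t \<in> dyadics" for t
    unfolding dyadic_integral_def by (rule limI[OF shift[OF that]])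
  have ext: "fs_extension f g (dyadic_limit f g)" using cont di by (simp add: fs_extension_def)
  then show "fs_integrable f g"
    unfolding fs_integrable_def dyadic_integrable_def using shift by (auto simp: convergent_def)
  fix x :: real assume x: "x \<in> {0..1}"
  have "fs_extension f g (fs_integral f g)" unfolding fs_integral_def by (rule someI[of "fs_extension f g", OF ext])
  then have F: "continuous_on {0..1} (fs_integral f g)"
    "\<And>t. t \<in> dyadics \<Longrightarrow> fs_integral f g t = dyadic_limit f g t"
    by (auto simp: fs_extension_def di)
  have "(\<lambda>n. fs_integral f g (dyadic_floor n x)) \<longlonglongrightarrow> fs_integral f g x"
    by (rule continuous_dyadic_floor_tendsto[OF F(1) x])
  then have "(\<lambda>n. dyadic_limit f g (dyadic_floor n x)) \<longlonglongrightarrow> fs_integral f g x"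
    using F(2) dyadic_floor_in_dyadics[OF x] by simp
  with continuous_dyadic_floor_tendsto[OF cont x] show "fs_integral f g x = dyadic_limit f g x"
    using LIMSEQ_unique by blast
qed

section \<open>The energy estimate\<close>

definition lp_tail :: "real \<Rightarrow> (nat \<Rightarrow> real) \<Rightarrow> nat \<Rightarrow> real" where
  "lp_tail r a N = (\<Sum>n. a (N + n) powr r) powr (1 / r)"

lemma lp_tail_nonneg [simp]: "0 \<le> lp_tail r a N"
  by (simp add: lp_tail_def)

lemma lp_partial_le_tail:
  assumes "0 < r" "summable (\<lambda>n. a n powr r)"
  shows "(\<Sum>j\<in>{N..<n}. a j powr r) powr (1 / r) \<le> lp_tail r a N"
proof -
  have "(\<Sum>j\<in>{N..<n}. a j powr r) = (\<Sum>i<n - N. a (N + i) powr r)"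
  proof (cases "N \<le> n")
    case True
    then show ?thesis
      using sum.shift_bounds_nat_ivl[of "\<lambda>j. a j powr r" 0 N "n - N"]
      by (simp add: lessThan_atLeast0 add.commute)
  qed simp
  also have "\<dots> \<le> (\<Sum>i. a (N + i) powr r)"
    using summable_ignore_initial_segment[OF assms(2), of N]
    by (intro sum_le_suminf) (auto simp: add.commute)
  finally show ?thesis unfolding lp_tail_def using assms(1)
    by (intro powr_mono2) (auto intro: sum_nonneg)
qed

lemma le_lp_tail:
  assumes "0 < r" "summable (\<lambda>n. a n powr r)" "0 \<le> a N"
  shows "a N \<le> lp_tail r a N"
  using lp_partial_le_tail[OF assms(1,2), of N "Suc N"] assms by (simp add: powr_powr)

lemma Hoelder_lp_tail:
  assumes "1 < p" "1 < q" "1 / p + 1 / q = 1"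
    and a: "\<And>n. 0 \<le> a n" "summable (\<lambda>n. a n powr p)"
    and b: "\<And>n. 0 \<le> b n" "summable (\<lambda>n. b n powr q)"
  shows "(\<Sum>j\<in>{N..<n}. a j * b j) \<le> lp_tail p a N * lp_tail q b N"
proof -
  have "(\<Sum>j\<in>{N..<n}. a j * b j)
      \<le> (\<Sum>j\<in>{N..<n}. a j powr p) powr (1 / p) * (\<Sum>j\<in>{N..<n}. b j powr q) powr (1 / q)"
    using assms by (intro Hoelder_inequality_sum) auto
  also have "\<dots> \<le> lp_tail p a N * lp_tail q b N"
    using assms by (intro mult_mono lp_partial_le_tail) auto
  finally show ?thesis .
qed

text \<open>
  The left halves, as well as the right halves, of a family of intervals form a subfamily of the next level.
\<close>
lemma sum_every_other_le:
  fixes h :: "nat \<Rightarrow> real"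
  assumes "\<And>i. 0 \<le> h i" "S \<subseteq> {..<2 ^ n}" "\<And>k. \<phi> k = 2 * k \<or> \<phi> k = Suc (2 * k)" "inj \<phi>"
  shows "(\<Sum>k\<in>S. h (\<phi> k)) \<le> (\<Sum>i<2 ^ Suc n. h i)"
proof -
  have "(\<Sum>k\<in>S. h (\<phi> k)) = sum h (\<phi> ` S)"
    using assms(4) by (subst sum.reindex) (auto intro: inj_on_subset)
  also have "\<dots> \<le> (\<Sum>i<2 ^ Suc n. h i)"
  proof (rule sum_mono2)
    show "\<phi> ` S \<subseteq> {..<2 ^ Suc n}"
    proof
      fix i assume "i \<in> \<phi> ` S"
      then obtain k where "i = \<phi> k" "k \<in> S" by blast
      then show "i \<in> {..<2 ^ Suc n}" using assms(2) assms(3)[of k] by auto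
    qed
  qed (use assms in auto)
  finally show ?thesis .
qed

text \<open>
  Hoelder's inequality for the left-half increments of \<open>f\<close> against the right-half increments of \<open>g\<close>.
\<close>
lemma sewing_sum_le:
  assumes pq: "1 < p" "1 < q" "1 / p + 1 / q = 1" and S: "S \<subseteq> {..<2 ^ n}"
  shows "(\<Sum>k\<in>S. \<bar>sewing_term f g n k\<bar>) \<le> accumulated_energy p f n * accumulated_energy q g n"
proof -
  have "finite S" using S finite_subset by blast
  have "(\<Sum>k\<in>S. \<bar>sewing_term f g n k\<bar>)
      = (\<Sum>k\<in>S. \<bar>incr f (Suc n) (2 * k)\<bar> * \<bar>incr g (Suc n) (Suc (2 * k))\<bar>)"
    by (simp add: abs_mult)
  also have "\<dots> \<le> (\<Sum>k\<in>S. \<bar>incr f (Suc n) (2 * k)\<bar> powr p) powr (1 / p)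
      * (\<Sum>k\<in>S. \<bar>incr g (Suc n) (Suc (2 * k))\<bar> powr q) powr (1 / q)"
    using pq \<open>finite S\<close> by (intro Hoelder_inequality_sum) auto
  also have "\<dots> \<le> dyadic_variation p f (Suc n) * dyadic_variation q g (Suc n)"
  proof (rule mult_mono)
    have "(\<Sum>k\<in>S. \<bar>incr f (Suc n) (2 * k)\<bar> powr p) \<le> (\<Sum>i<2 ^ Suc n. \<bar>incr f (Suc n) i\<bar> powr p)"
      using sum_every_other_le[where h="\<lambda>i. \<bar>incr f (Suc n) i\<bar> powr p" and \<phi>="\<lambda>k. 2 * k", OF _ S]
      by (auto simp: inj_def)
    then show "(\<Sum>k\<in>S. \<bar>incr f (Suc n) (2 * k)\<bar> powr p) powr (1 / p) \<le> dyadic_variation p f (Suc n)"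
      unfolding dyadic_variation_def using pq by (intro powr_mono2) (auto intro: sum_nonneg)
    have "(\<Sum>k\<in>S. \<bar>incr g (Suc n) (Suc (2 * k))\<bar> powr q) \<le> (\<Sum>i<2 ^ Suc n. \<bar>incr g (Suc n) i\<bar> powr q)"
      using sum_every_other_le[where h="\<lambda>i. \<bar>incr g (Suc n) i\<bar> powr q" and \<phi>="\<lambda>k. Suc (2 * k)", OF _ S]
      by (auto simp: inj_def)
    then show "(\<Sum>k\<in>S. \<bar>incr g (Suc n) (Suc (2 * k))\<bar> powr q) powr (1 / q) \<le> dyadic_variation q g (Suc n)"
      unfolding dyadic_variation_def using pq by (intro powr_mono2) (auto intro: sum_nonneg)
  qed auto
  also have "\<dots> \<le> accumulated_energy p f n * accumulated_energy q g n"
    using pq by (intro mult_mono dyadic_variation_le) auto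
  finally show ?thesis .
qed

lemma incr_le_accumulated_energy:
  assumes "1 < p"
  shows "k < 2 ^ n \<Longrightarrow> \<bar>incr f n k\<bar> \<le> accumulated_energy p f n"
    and "k < 2 ^ Suc n \<Longrightarrow> \<bar>incr f (Suc n) k\<bar> \<le> accumulated_energy p f n"
  using incr_le_dyadic_variation[OF assms, of k n f] incr_le_dyadic_variation[OF assms, of k "Suc n" f]
    dyadic_variation_le[OF assms, of f n] by linarith+

text \<open>
  At level \<open>j\<close> the sewing terms contribute at most \<open>A j * B j\<close> and each of the two boundary terms at most
  \<open>(A j + H j / 2) * B j\<close>; summed over the levels this is at most \<open>3 * a * b + 2 * h * b\<close>. The three products at level
  \<open>N\<close> add \<open>(2 * a + h) * b\<close> and twice \<open>(a + 2 * h) * (b + k)\<close>.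
\<close>
lemma energy_Young_Loeve:
  assumes pq: "1 < p" "1 < q" "1 / p + 1 / q = 1"
    and f: "continuous_on {0..1} f" "summable (level_sup f)"
      "summable (\<lambda>n. accumulated_energy p f n powr p)" "summable (\<lambda>n. level_sup_tail f n powr p)"
    and g: "continuous_on {0..1} g" "summable (level_sup g)"
      "summable (\<lambda>n. accumulated_energy q g n powr q)" "summable (\<lambda>n. level_sup_tail g n powr q)"
    and lim: "left_sum f g t \<longlonglongrightarrow> It" "left_sum f g s \<longlonglongrightarrow> Is"
    and st: "0 \<le> s" "s \<le> \<xi>" "\<xi> \<le> t" "t \<le> 1" "t - s \<le> 1 / 2 ^ N"
  shows "\<bar>It - Is - f \<xi> * (g t - g s)\<bar>
    \<le> 8 * (lp_tail p (accumulated_energy p f) N + 1 / 2 * lp_tail p (level_sup_tail f) N)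
        * (lp_tail q (accumulated_energy q g) N + 1 / 2 * lp_tail q (level_sup_tail g) N)"
proof -
  define A where "A = accumulated_energy p f"
  define B where "B = accumulated_energy q g"
  define H where "H = level_sup_tail f"
  define J where "J = level_sup_tail g"
  define a where "a = lp_tail p A N"
  define b where "b = lp_tail q B N"
  define h where "h = lp_tail p H N / 2"
  define k where "k = lp_tail q J N / 2"
  have nn: "0 \<le> A n" "0 \<le> B n" "0 \<le> H n" "0 \<le> J n" for n
    using level_sup_tail_nonneg f g by (simp_all add: A_def B_def H_def J_def)
  have abhk: "0 \<le> a" "0 \<le> b" "0 \<le> h" "0 \<le> k" by (simp_all add: a_def b_def h_def k_def)
  have le: "A N \<le> a" "B N \<le> b" "H N \<le> 2 * h" "J N \<le> 2 * k"
    using le_lp_tail[of p A N] le_lp_tail[of q B N] le_lp_tail[of p H N] le_lp_tail[of q J N]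
      pq f g nn by (simp_all add: a_def b_def h_def k_def A_def B_def H_def J_def)
  have st': "0 \<le> s" "s \<le> t" "t \<le> 1" "t - s \<le> 1 / 2 ^ N" using st by auto
  have mem: "s \<in> {0..1}" "t \<in> {0..1}" "\<xi> \<in> {0..1}" using st by auto
  note incrA = incr_le_accumulated_energy[OF pq(1), of _ _ f, folded A_def]
  note incrB = incr_le_accumulated_energy[OF pq(2), of _ _ g, folded B_def]
  have ffl: "\<bar>f x - f (dyadic_floor j x)\<bar> \<le> A j + H j / 2" if "x \<in> {0..1}" for x j
    unfolding H_def by (rule abs_diff_dyadic_floor_le[OF f(1,2) that incrA(1)])
  have gfl: "\<bar>g x - g (dyadic_floor j x)\<bar> \<le> B j + J j / 2" if "x \<in> {0..1}" for x j
    unfolding J_def by (rule abs_diff_dyadic_floor_le[OF g(1,2) that incrB(1)])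
  have boundary: "\<bar>f x - f (dyadic_floor j x)\<bar> * \<bar>g (dyadic_floor (Suc j) x) - g (dyadic_floor j x)\<bar>
      \<le> (A j + H j / 2) * B j" if "x \<in> {0..1}" for x j
    using nn[of j] that by (intro mult_mono ffl incr_dyadic_floor_Suc_le incrB(2)) auto
  have E: "(\<Sum>j\<in>{N..<n}. (\<Sum>k\<in>{dyadic_index j s..<dyadic_index j t}. \<bar>sewing_term f g j k\<bar>)
         + \<bar>f t - f (dyadic_floor j t)\<bar> * \<bar>g (dyadic_floor (Suc j) t) - g (dyadic_floor j t)\<bar>
         + \<bar>f s - f (dyadic_floor j s)\<bar> * \<bar>g (dyadic_floor (Suc j) s) - g (dyadic_floor j s)\<bar>)
      \<le> 3 * (a * b) + 2 * (h * b)" (is "sum ?e _ \<le> _") for n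
  proof -
    have "sum ?e {N..<n} \<le> (\<Sum>j\<in>{N..<n}. 3 * (A j * B j) + H j * B j)"
    proof (rule sum_mono)
      fix j
      have "{dyadic_index j s..<dyadic_index j t} \<subseteq> {..<2 ^ j}"
        using dyadic_index_le[of t j] st' by auto
      then have "(\<Sum>k\<in>{dyadic_index j s..<dyadic_index j t}. \<bar>sewing_term f g j k\<bar>) \<le> A j * B j"
        unfolding A_def B_def by (rule sewing_sum_le[OF pq])
      then have "?e j \<le> A j * B j + (A j + H j / 2) * B j + (A j + H j / 2) * B j"
        by (intro add_mono boundary mem)
      then show "?e j \<le> 3 * (A j * B j) + H j * B j" by (simp add: algebra_simps)
    qed
    also have "\<dots> = 3 * (\<Sum>j\<in>{N..<n}. A j * B j) + (\<Sum>j\<in>{N..<n}. H j * B j)"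
      by (simp add: sum.distrib sum_distrib_left)
    also have "\<dots> \<le> 3 * (a * b) + (2 * h) * b"
    proof -
      have "(\<Sum>j\<in>{N..<n}. A j * B j) \<le> a * b"
        unfolding a_def b_def using nn f g by (intro Hoelder_lp_tail pq) (auto simp: A_def B_def)
      moreover have "(\<Sum>j\<in>{N..<n}. H j * B j) \<le> lp_tail p H N * lp_tail q B N"
        using nn f g by (intro Hoelder_lp_tail pq) (auto simp: H_def B_def)
      ultimately show ?thesis by (simp add: h_def b_def)
    qed
    finally show ?thesis by simp
  qed
  note basic = Young_Loeve_basic[OF st' g(1) lim E, of "f \<xi>"]
  \<comment> \<open>The point \<open>\<xi>\<close> may be up to two grid lengths above \<open>s\<^sub>N\<close>, so go through \<open>\<xi>\<^sub>N\<close>.\<close>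
  have "\<bar>f (dyadic_floor N s) - f \<xi>\<bar> \<le> 2 * a + h"
  proof -
    have "\<bar>f (dyadic_floor N \<xi>) - f (dyadic_floor N s)\<bar> \<le> A N"
      using st by (intro incr_dyadic_floor_le incrA(1)) auto
    with ffl[OF mem(3), of N] le show ?thesis by linarith
  qed
  moreover have "\<bar>g (dyadic_floor N t) - g (dyadic_floor N s)\<bar> \<le> b"
    by (rule order_trans[OF incr_dyadic_floor_le[OF st' incrB(1)] le(2)])
  ultimately have 1: "\<bar>f (dyadic_floor N s) - f \<xi>\<bar> * \<bar>g (dyadic_floor N t) - g (dyadic_floor N s)\<bar>
      \<le> (2 * a + h) * b"
    using abhk by (intro mult_mono) auto
  have g2: "\<bar>g x - g (dyadic_floor N x)\<bar> \<le> b + k" if "x \<in> {0..1}" for x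
    using gfl[OF that, of N] le by linarith
  have "\<bar>f t - f \<xi>\<bar> \<le> a + 2 * h"
  proof -
    have "\<bar>f t - f \<xi>\<bar> \<le> A N + H N"
      unfolding H_def using st by (intro oscillation_le[OF f(1,2)] incrA(1)) auto
    then show ?thesis using le by linarith
  qed
  then have 2: "\<bar>f t - f \<xi>\<bar> * \<bar>g t - g (dyadic_floor N t)\<bar> \<le> (a + 2 * h) * (b + k)"
    using abhk by (intro mult_mono g2 mem) auto
  have "\<bar>f s - f \<xi>\<bar> \<le> a + 2 * h"
  proof -
    have "\<bar>f \<xi> - f s\<bar> \<le> A N + H N"
      unfolding H_def using st by (intro oscillation_le[OF f(1,2)] incrA(1)) auto
    then show ?thesis using le by linarith
  qed
  then have 3: "\<bar>f s - f \<xi>\<bar> * \<bar>g s - g (dyadic_floor N s)\<bar> \<le> (a + 2 * h) * (b + k)"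
    using abhk by (intro mult_mono g2 mem) auto
  have "\<bar>It - Is - f \<xi> * (g t - g s)\<bar>
      \<le> 3 * (a * b) + 2 * (h * b) + (2 * a + h) * b + (a + 2 * h) * (b + k) + (a + 2 * h) * (b + k)"
    using basic 1 2 3 by linarith
  also have "\<dots> = 7 * (a * b) + 7 * (h * b) + 2 * (a * k) + 4 * (h * k)"
    by (simp add: algebra_simps)
  also have "\<dots> \<le> 8 * (a * b) + 8 * (h * b) + 8 * (a * k) + 8 * (h * k)"
    using abhk by (intro add_mono mult_right_mono) auto
  also have "\<dots> = 8 * (a + h) * (b + k)" by (simp add: algebra_simps)
  finally show ?thesis by (simp add: a_def b_def h_def k_def A_def B_def H_def J_def)
qed

section \<open>Extended norms as real series\<close>

lemma infsum_ennreal_eq_suminf: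
  fixes u :: "nat \<Rightarrow> ennreal"
  shows "infsum u UNIV = suminf u"
proof -
  have "u summable_on UNIV" by (rule nonneg_summable_on_complete) simp
  then have "u sums infsum u UNIV" by (intro has_sum_imp_sums has_sum_infsum)
  then show ?thesis by (rule sums_unique)
qed

text \<open>
  Expresses norms over index sets other than the natural numbers, such as the levels from \<open>-1\<close> on, by
  real series along an enumeration.
\<close>
lemma lp_norm_eq_suminf:
  fixes h :: "nat \<Rightarrow> 'i" and u :: "'i \<Rightarrow> ennreal"
  assumes "bij_betw h UNIV S" "\<And>n. u (h n) = ennreal (a n)" "\<And>n. 0 \<le> a n" "summable (\<lambda>n. a n powr r)"
  shows "lp_norm r S u = ennreal ((\<Sum>n. a n powr r) powr (1 / r))"
proof -
  have "(\<Sum>\<^sub>\<infinity>i\<in>S. ennreal_powr (u i) r) = (\<Sum>\<^sub>\<infinity>n. ennreal_powr (u (h n)) r)"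
    by (rule infsum_reindex_bij_betw[symmetric, OF assms(1)])
  also have "\<dots> = (\<Sum>n. ennreal (a n powr r))"
    unfolding infsum_ennreal_eq_suminf by (simp add: assms(2,3) ennreal_powr_def)
  also have "\<dots> = ennreal (\<Sum>n. a n powr r)"
    by (intro suminf_ennreal2 assms) auto
  finally show ?thesis
    using suminf_nonneg[OF assms(4)] by (simp add: lp_norm_def ennreal_powr_def)
qed

lemma lp_norm_atLeast:
  assumes "\<And>n. 0 \<le> a n" "summable (\<lambda>n. a n powr r)"
  shows "lp_norm r {N..} (\<lambda>n. ennreal (a n)) = ennreal (lp_tail r a N)"
  unfolding lp_tail_def
proof (rule lp_norm_eq_suminf)
  show "bij_betw (\<lambda>n. N + n) UNIV {N..}"
    by (rule bij_betwI[where g="\<lambda>n. n - N"]) auto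
  show "summable (\<lambda>n. a (N + n) powr r)"
    using summable_ignore_initial_segment[OF assms(2), of N] by (simp add: add.commute)
qed (use assms in auto)

lemma schauder_tail_eq:
  assumes "summable (level_sup f)"
  shows "schauder_tail f = (\<lambda>n. ennreal (level_sup_tail f n))"
proof
  fix n
  have "schauder_tail f n = (\<Sum>j. ennreal (level_sup f (n + j)))"
    by (simp add: schauder_tail_def level_sup_def)
  also have "\<dots> = ennreal (level_sup_tail f n)"
    unfolding level_sup_tail_def by (intro suminf_ennreal2 summable_level_sup_shift assms) auto
  finally show "schauder_tail f n = ennreal (level_sup_tail f n)" .
qed

lemma local_energy_eq:
  assumes "summable (level_sup f)"
    "summable (\<lambda>n. accumulated_energy p f n powr p)" "summable (\<lambda>n. level_sup_tail f n powr p)"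
  shows "local_energy p f N
    = ennreal (lp_tail p (accumulated_energy p f) N + 1 / 2 * lp_tail p (level_sup_tail f) N)"
proof -
  define x where "x = lp_tail p (accumulated_energy p f) N"
  define y where "y = lp_tail p (level_sup_tail f) N"
  have "local_energy p f N = ennreal x + ennreal (1 / 2) * ennreal y"
    unfolding local_energy_def schauder_tail_eq[OF assms(1)] x_def y_def
    using lp_norm_atLeast[of "accumulated_energy p f" p N] lp_norm_atLeast[of "level_sup_tail f" p N]
      assms level_sup_tail_nonneg[OF assms(1)] by simp
  also have "ennreal (1 / 2) * ennreal y = ennreal (1 / 2 * y)"
    by (rule ennreal_mult[symmetric]) (auto simp: y_def)
  also have "ennreal x + ennreal (1 / 2 * y) = ennreal (x + 1 / 2 * y)"
    by (rule ennreal_plus[symmetric]) (auto simp: x_def y_def)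
  finally show ?thesis by (simp add: x_def y_def)
qed

lemma energy_spaceI:
  assumes cont: "continuous_on {0..1} f" and "summable (level_sup f)"
    "summable (\<lambda>n. level_energy p f (int n) powr p)" "summable (\<lambda>n. level_sup_tail f n powr p)"
  shows "f \<in> energy_space p"
proof -
  obtain B where B: "\<And>y. y \<in> {0..1} \<Longrightarrow> \<bar>f y\<bar> \<le> B"
    using continuous_on_unit_interval_bounded[OF cont] by blast
  have "(SUP t\<in>{0..1}. ennreal \<bar>f t\<bar>) \<le> ennreal B"
    by (intro SUP_least ennreal_leI B)
  then have "(SUP t\<in>{0..1}. ennreal \<bar>f t\<bar>) < \<infinity>"
    by (rule order_le_less_trans) simp
  moreover have "lp_norm p {-1..} (\<lambda>n. ennreal (level_energy p f n)) < \<infinity>"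
  proof -
    have bij: "bij_betw (\<lambda>n. int n - 1) UNIV {-1..}"
      by (rule bij_betwI[where g="\<lambda>i. nat (i + 1)"]) auto
    have "summable (\<lambda>n. level_energy p f (int (Suc n) - 1) powr p)" using assms(3) by simp
    then have "summable (\<lambda>n. level_energy p f (int n - 1) powr p)" by (subst (asm) summable_Suc_iff)
    from lp_norm_eq_suminf[OF bij _ _ this] show ?thesis by simp
  qed
  moreover have "lp_norm p UNIV (schauder_tail f) < \<infinity>"
    using lp_norm_eq_suminf[of id UNIV "schauder_tail f" "level_sup_tail f" p] assms(2,4)
    by (simp add: schauder_tail_eq level_sup_tail_nonneg)
  ultimately show ?thesis using cont by (simp add: energy_space_def energy_norm_def)
qed

section \<open>Hoelder functions have finite energy\<close>

lemma geometric_bound_powr_summable: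
  fixes a :: "nat \<Rightarrow> real"
  assumes "\<And>n. 0 \<le> a n" "\<And>n. a n \<le> K * \<tau> ^ n" "0 < \<tau>" "\<tau> < 1" "0 < r"
  shows "summable (\<lambda>n. a n powr r)"
proof (rule summable_comparison_test'[where g="\<lambda>n. K powr r * (\<tau> powr r) ^ n" and N=0])
  have "\<tau> powr r < 1" using assms powr_less_mono2[of r \<tau> 1] by simp
  then show "summable (\<lambda>n. K powr r * (\<tau> powr r) ^ n)"
    by (intro summable_mult summable_geometric) simp
  have K: "0 \<le> K" using order_trans[OF assms(1)[of 0] assms(2)[of 0]] by simp
  fix n :: nat
  have "a n powr r \<le> (K * \<tau> ^ n) powr r" using assms by (intro powr_mono2) auto
  also have "\<dots> = K powr r * (\<tau> powr r) ^ n"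
    using assms K by (simp add: powr_mult powr_powr powr_realpow[symmetric] mult.commute)
  finally show "norm (a n powr r) \<le> K powr r * (\<tau> powr r) ^ n" by simp
qed

lemma hoelder_level_sup_le:
  assumes "hoelder_bound C \<alpha> f" "0 \<le> \<alpha>"
  shows "k < 2 ^ n \<Longrightarrow> \<bar>2 powr (- (real n / 2)) * schauder_coeff f (int n) k\<bar> \<le> 2 * C * (2 powr (- \<alpha>)) ^ n"
    and "level_sup f n \<le> 2 * C * (2 powr (- \<alpha>)) ^ n"
proof -
  define \<mu> where "\<mu> = (2::real) powr (- \<alpha>)"
  have C: "0 \<le> C" using assms by (simp add: hoelder_bound_def)
  have \<mu>: "0 < \<mu>" "\<mu> \<le> 1" using assms powr_mono[of "-\<alpha>" 0 2] by (simp_all add: \<mu>_def)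
  have coeff: "\<bar>2 powr (- (real n / 2)) * schauder_coeff f (int n) k\<bar> \<le> 2 * C * \<mu> ^ n"
    if "k < 2 ^ n" for k
  proof -
    have "\<bar>incr f (Suc n) (2 * k)\<bar> \<le> C * \<mu> ^ Suc n" "\<bar>incr f (Suc n) (Suc (2 * k))\<bar> \<le> C * \<mu> ^ Suc n"
      unfolding \<mu>_def by (rule hoelder_incr_le[OF assms], use that in simp)+
    moreover have "C * \<mu> ^ Suc n \<le> C * \<mu> ^ n"
      using C \<mu> by (intro mult_left_mono) (auto simp: mult_left_le_one_le)
    moreover have "2 powr (- (real n / 2)) * schauder_coeff f (int n) k
        = incr f (Suc n) (2 * k) - incr f (Suc n) (Suc (2 * k))"
      unfolding incr_refine by (simp add: field_simps)
    ultimately show ?thesis by linarith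
  qed
  then show "k < 2 ^ n \<Longrightarrow> \<bar>2 powr (- (real n / 2)) * schauder_coeff f (int n) k\<bar> \<le> 2 * C * (2 powr (- \<alpha>)) ^ n"
    by (simp add: \<mu>_def)
  have "(0::nat) \<in> {..<2 ^ n}" by simp
  then have fin: "finite {..<2 ^ n :: nat}" "{..<2 ^ n :: nat} \<noteq> {}" by blast+
  obtain k where k: "k < 2 ^ n"
    "(SUP k\<in>{..<2 ^ n}. \<bar>schauder_coeff f (int n) k\<bar>) = \<bar>schauder_coeff f (int n) k\<bar>"
  proof -
    have "(SUP k\<in>{..<2 ^ n}. \<bar>schauder_coeff f (int n) k\<bar>) = Max ((\<lambda>k. \<bar>schauder_coeff f (int n) k\<bar>) ` {..<2 ^ n})"
      using fin by (intro cSup_eq_Max) auto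
    moreover have "Max ((\<lambda>k. \<bar>schauder_coeff f (int n) k\<bar>) ` {..<2 ^ n}) \<in> (\<lambda>k. \<bar>schauder_coeff f (int n) k\<bar>) ` {..<2 ^ n}"
      using fin by (intro Max_in) auto
    ultimately show thesis using that by auto
  qed
  then show "level_sup f n \<le> 2 * C * (2 powr (- \<alpha>)) ^ n"
    using coeff[OF k(1)] by (simp add: level_sup_def abs_mult \<mu>_def)
qed

lemma hoelder_summable_level_sup:
  assumes "hoelder_bound C \<alpha> f" "0 < \<alpha>"
  shows "summable (level_sup f)"
    and "level_sup_tail f n \<le> 2 * C / (1 - 2 powr (- \<alpha>)) * (2 powr (- \<alpha>)) ^ n"
proof -
  define \<mu> where "\<mu> = (2::real) powr (- \<alpha>)"
  have \<mu>: "0 < \<mu>" "\<mu> < 1" using assms powr_less_mono[of "-\<alpha>" 0 2] by (simp_all add: \<mu>_def)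
  have le: "level_sup f n \<le> 2 * C * \<mu> ^ n" for n
    unfolding \<mu>_def using assms by (intro hoelder_level_sup_le) auto
  have geo: "summable (\<lambda>n. K * \<mu> ^ n)" for K :: real
    using \<mu> by (intro summable_mult summable_geometric) simp
  show *: "summable (level_sup f)"
    by (rule summable_comparison_test'[OF geo[of "2 * C"], of 0]) (use le in simp)
  have "level_sup_tail f n \<le> (\<Sum>j. (2 * C * \<mu> ^ n) * \<mu> ^ j)"
    unfolding level_sup_tail_def using le[of "n + _"]
    by (intro suminf_le summable_level_sup_shift[OF *] geo) (simp add: power_add mult.assoc)
  also have "\<dots> = (2 * C * \<mu> ^ n) * (1 / (1 - \<mu>))"
    using \<mu> by (subst suminf_mult) (auto intro: summable_geometric simp: suminf_geometric)
  finally show "level_sup_tail f n \<le> 2 * C / (1 - 2 powr (- \<alpha>)) * (2 powr (- \<alpha>)) ^ n"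
    by (simp add: \<mu>_def)
qed

text \<open>
  There are \<open>2 ^ n\<close> second differences of size \<open>2 powr (- n * \<alpha>)\<close>, so the bound decays exactly if
  \<open>1 / p < \<alpha>\<close>.
\<close>
lemma hoelder_level_energy_le:
  assumes "hoelder_bound C \<alpha> f" "0 \<le> \<alpha>" "1 < p"
  shows "level_energy p f (int n) \<le> 2 * C * (2 powr (1 / p - \<alpha>)) ^ n"
proof -
  define \<mu> where "\<mu> = (2::real) powr (- \<alpha>)"
  have C: "0 \<le> C" using assms by (simp add: hoelder_bound_def)
  have \<mu>: "0 < \<mu>" by (simp add: \<mu>_def)
  have "(\<Sum>k<2 ^ n. \<bar>2 powr (- (real n / 2)) * schauder_coeff f (int n) k\<bar> powr p)
      \<le> (\<Sum>k<(2::nat) ^ n. (2 * C * \<mu> ^ n) powr p)"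
    unfolding \<mu>_def using assms by (intro sum_mono powr_mono2 hoelder_level_sup_le(1)) auto
  then have "level_energy p f (int n) \<le> (2 ^ n * (2 * C * \<mu> ^ n) powr p) powr (1 / p)"
    unfolding level_energy_nat[OF assms(3)] using assms by (intro powr_mono2) (auto intro: sum_nonneg)
  also have "\<dots> = (2 ^ n) powr (1 / p) * (2 * C * \<mu> ^ n)"
    using assms C \<mu> by (subst powr_mult) (auto simp: powr_powr)
  also have "(2 ^ n) powr (1 / p) = (2 powr (1 / p)) ^ n"
    by (simp add: powr_realpow[symmetric] powr_powr mult.commute)
  also have "(2 powr (1 / p)) ^ n * (2 * C * \<mu> ^ n) = 2 * C * (2 powr (1 / p - \<alpha>)) ^ n"
    by (simp add: \<mu>_def power_mult_distrib[symmetric] powr_add[symmetric] mult_ac)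
  finally show ?thesis .
qed

text \<open>
  The accumulated energy solves \<open>A (n + 1) = c * A n + \<zeta> (n + 1)\<close>, so it inherits every geometric rate
  \<open>\<tau>\<close> of \<open>\<zeta>\<close> that is strictly slower than \<open>c\<close>.
\<close>
lemma accumulated_energy_geometric:
  assumes \<tau>: "2 powr (- (1 - 1 / p)) < \<tau>"
    and z: "\<And>n. level_energy p f (int n) \<le> K * \<tau> ^ n" and "0 \<le> K"
  obtains L where "\<And>n. accumulated_energy p f n \<le> L * \<tau> ^ n"
proof -
  define c where "c = (2::real) powr (- (1 - 1 / p))"
  have c: "0 < c" "c < \<tau>" using \<tau> by (auto simp: c_def)
  \<comment> \<open>The second entry makes \<open>L\<close> large enough that \<open>c * L + K * \<tau> \<le> L * \<tau>\<close>, which carries the induction.\<close>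
  define L where "L = max (accumulated_energy p f 0) (K * \<tau> / (\<tau> - c))"
  have "L \<ge> K * \<tau> / (\<tau> - c)" by (simp add: L_def)
  then have L: "c * L + K * \<tau> \<le> L * \<tau>" using c by (simp add: field_simps)
  have "accumulated_energy p f n \<le> L * \<tau> ^ n" for n
  proof (induction n)
    case (Suc n)
    have "accumulated_energy p f (Suc n) \<le> c * (L * \<tau> ^ n) + K * \<tau> ^ Suc n"
      unfolding accumulated_energy_Suc c_def[symmetric]
      by (intro add_mono mult_left_mono Suc z) (use c in simp)
    also have "\<dots> = (c * L + K * \<tau>) * \<tau> ^ n" by (simp add: algebra_simps)
    also have "\<dots> \<le> (L * \<tau>) * \<tau> ^ n" using L c by (intro mult_right_mono) auto
    finally show ?case by (simp add: mult_ac)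
  qed (simp add: L_def)
  then show thesis by (rule that)
qed

lemma hoelder_energy_summable:
  assumes f: "hoelder_bound C \<alpha> f" and p: "1 < p" "1 / p < \<alpha>"
  shows "summable (\<lambda>n. level_energy p f (int n) powr p)"
    and "summable (\<lambda>n. accumulated_energy p f n powr p)"
    and "summable (\<lambda>n. level_sup_tail f n powr p)"
proof -
  have C: "0 \<le> C" using f by (simp add: hoelder_bound_def)
  have \<alpha>: "0 < \<alpha>" using p by (meson less_trans zero_less_divide_1_iff zero_less_one)
  define \<sigma> where "\<sigma> = (2::real) powr (1 / p - \<alpha>)"
  define c where "c = (2::real) powr (- (1 - 1 / p))"
  have \<sigma>: "0 < \<sigma>" "\<sigma> < 1" using p powr_less_mono[of "1 / p - \<alpha>" 0 2] by (simp_all add: \<sigma>_def)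
  have "c < 1" using p powr_less_mono[of "- (1 - 1 / p)" 0 2] by (simp add: c_def)
  have le: "level_energy p f (int n) \<le> 2 * C * \<sigma> ^ n" for n
    unfolding \<sigma>_def using f \<alpha> p by (intro hoelder_level_energy_le) auto
  show "summable (\<lambda>n. level_energy p f (int n) powr p)"
    using p by (intro geometric_bound_powr_summable[OF _ le \<sigma>]) auto
  \<comment> \<open>For \<open>\<alpha> = 1\<close> the rates \<open>\<sigma>\<close> and \<open>c\<close> coincide, so a strictly larger \<open>\<tau>\<close> has to be chosen.\<close>
  obtain \<tau> where \<tau>: "max \<sigma> c < \<tau>" "\<tau> < 1"
    using dense[of "max \<sigma> c" 1] \<sigma> \<open>c < 1\<close> by auto
  have le': "level_energy p f (int n) \<le> 2 * C * \<tau> ^ n" for n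
    by (rule order_trans[OF le]) (use C \<sigma> \<tau> in \<open>auto intro!: mult_left_mono power_mono\<close>)
  obtain L where L: "\<And>n. accumulated_energy p f n \<le> L * \<tau> ^ n"
    using accumulated_energy_geometric[OF _ le'] \<tau>(1) C by (auto simp: c_def)
  show "summable (\<lambda>n. accumulated_energy p f n powr p)"
    using p \<sigma> \<tau> by (intro geometric_bound_powr_summable[OF _ L]) auto
  show "summable (\<lambda>n. level_sup_tail f n powr p)"
    using p \<alpha> powr_less_mono[of "-\<alpha>" 0 2] level_sup_tail_nonneg[OF hoelder_summable_level_sup(1)[OF f \<alpha>]]
    by (intro geometric_bound_powr_summable[OF _ hoelder_summable_level_sup(2)[OF f \<alpha>]]) auto
qed

lemma hoelder_in_energy_space:
  assumes "f \<in> hoelder_space \<alpha>" "1 < p" "1 / p < \<alpha>"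
  shows "f \<in> energy_space p"
proof -
  have \<alpha>: "0 < \<alpha>" using assms(2,3) by (meson less_trans zero_less_divide_1_iff zero_less_one)
  obtain C where C: "hoelder_bound C \<alpha> f" using assms hoelder_space_iff_bound by blast
  show ?thesis
    by (intro energy_spaceI hoelder_continuous_on[OF assms(1) \<alpha>]
        hoelder_summable_level_sup[OF C \<alpha>] hoelder_energy_summable[OF C assms(2,3)])
qed

text \<open>
  Convergence at every real endpoint is recorded besides the existence of the integral because the energy
  estimate compares two arbitrary endpoints.
\<close>
lemma hoelder_fs_integral:
  assumes f: "f \<in> hoelder_space \<alpha>" "0 < \<alpha>" and g: "g \<in> hoelder_space \<beta>" "0 < \<beta>"
    and ab: "1 < \<alpha> + \<beta>"
  shows "fs_integrable f g"
    and "\<And>t. t \<in> {0..1} \<Longrightarrow> left_sum f g t \<longlonglongrightarrow> fs_integral f g t"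
    and "\<And>t. t \<in> {0..1} \<Longrightarrow> has_young_integral f g 0 t (fs_integral f g t)"
proof -
  obtain C D where C: "hoelder_bound C \<alpha> f" and D: "hoelder_bound D \<beta> g"
    using f g hoelder_space_iff_bound by blast
  note lim = hoelder_left_sum_tendsto[OF C f(2) D g(2) ab]
  note cont = hoelder_dyadic_limit_continuous[OF C f(2) D g(2) ab]
  have fs: "fs_integrable f g" "\<And>x. x \<in> {0..1} \<Longrightarrow> fs_integral f g x = dyadic_limit f g x"
    using fs_integral_eq_dyadic_limit[of f g] lim cont by blast+
  show "fs_integrable f g" by (rule fs(1))
  fix t :: real assume t: "t \<in> {0..1}"
  show "left_sum f g t \<longlonglongrightarrow> fs_integral f g t" using lim[OF t] fs(2)[OF t] by simp
  obtain K where K: "0 \<le> K"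
    "\<And>s \<xi> t. 0 \<le> s \<Longrightarrow> s \<le> \<xi> \<Longrightarrow> \<xi> \<le> t \<Longrightarrow> t \<le> 1 \<Longrightarrow>
       \<bar>dyadic_limit f g t - dyadic_limit f g s - f \<xi> * (g t - g s)\<bar> \<le> K * (t - s) powr (\<alpha> + \<beta>)"
    using hoelder_Young_Loeve[OF C f(2) D g(2) ab] by blast
  have "has_young_integral f g 0 t (dyadic_limit f g t - dyadic_limit f g 0)"
    using t by (intro has_young_integralI[OF K(1) ab _ K(2)]) auto
  then show "has_young_integral f g 0 t (fs_integral f g t)" using fs(2)[OF t] by simp
qed

section \<open>Existence, Young integral, integration by parts and the dyadic Young--Loeve estimate\<close>

theorem theorem4p2:
  fixes \<alpha> \<beta> :: real and f g :: "real \<Rightarrow> real"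
  assumes "0 < \<alpha>" "\<alpha> \<le> 1" "0 < \<beta>" "\<beta> \<le> 1" "\<alpha> + \<beta> > 1"
    and "f \<in> hoelder_space \<alpha>" "g \<in> hoelder_space \<beta>"
  shows "\<exists>p q :: real. 1 < p \<and> 1 < q \<and> 1 / p + 1 / q = 1
    \<and> f \<in> energy_space p \<and> g \<in> energy_space q
    \<and> fs_integrable f g \<and> fs_integrable g f
    \<and> (\<forall>t\<in>{0..1}. has_young_integral f g 0 t (fs_integral f g t))
    \<and> (\<forall>t\<in>{0..1}. has_young_integral g f 0 t (fs_integral g f t))
    \<and> (\<forall>s\<in>{0..1}. \<forall>t\<in>{0..1}.
         fs_integral_between f g s t + fs_integral_between g f s t = f t * g t - f s * g s)
    \<and> (\<forall>s \<xi> t. \<forall>N::nat. 0 \<le> s \<and> s \<le> \<xi> \<and> \<xi> \<le> t \<and> t \<le> 1 \<and> t - s \<le> 1 / 2 ^ N \<longrightarrow>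
         ennreal \<bar>fs_integral_between f g s t - f \<xi> * (g t - g s)\<bar>
           \<le> 8 * local_energy p f N * local_energy q g N)"
proof -
  \<comment> \<open>The number \<open>1 / p\<close> is taken halfway between \<open>1 - \<beta>\<close> and \<open>\<alpha>\<close>.\<close>
  define w where "w = (\<alpha> + 1 - \<beta>) / 2"
  define p where "p = 1 / w"
  define q where "q = 1 / (1 - w)"
  have w: "0 < w" "w < 1" "w < \<alpha>" "1 - w < \<beta>" using assms by (auto simp: w_def field_simps)
  have p: "1 < p" "1 / p < \<alpha>" and q: "1 < q" "1 / q < \<beta>" and pq: "1 / p + 1 / q = 1"
    using w by (simp_all add: p_def q_def)
  have ba: "1 < \<beta> + \<alpha>" using assms by simp
  note fg = hoelder_fs_integral[OF assms(6,1,7,3,5)]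
  note gf = hoelder_fs_integral[OF assms(7,3,6,1) ba]
  obtain C D where C: "hoelder_bound C \<alpha> f" and D: "hoelder_bound D \<beta> g"
    using assms hoelder_space_iff_bound by blast
  note f_sum = hoelder_summable_level_sup(1)[OF C assms(1)] hoelder_energy_summable(2,3)[OF C p]
  note g_sum = hoelder_summable_level_sup(1)[OF D assms(3)] hoelder_energy_summable(2,3)[OF D q]
  have parts: "fs_integral f g t + fs_integral g f t = f t * g t - f 0 * g 0" if "t \<in> {0..1}" for t
    using that by (intro young_integral_by_parts[OF fg(3) gf(3)]) auto
  have "fs_integral_between f g s t + fs_integral_between g f s t = f t * g t - f s * g s"
    if "s \<in> {0..1}" "t \<in> {0..1}" for s t
    using parts[OF that(1)] parts[OF that(2)] by (simp add: fs_integral_between_def)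
  moreover have "ennreal \<bar>fs_integral_between f g s t - f \<xi> * (g t - g s)\<bar>
           \<le> 8 * local_energy p f N * local_energy q g N"
    if st: "0 \<le> s" "s \<le> \<xi>" "\<xi> \<le> t" "t \<le> 1" "t - s \<le> 1 / 2 ^ N" for s \<xi> t and N :: nat
  proof -
    define Lf where "Lf = lp_tail p (accumulated_energy p f) N + 1 / 2 * lp_tail p (level_sup_tail f) N"
    define Lg where "Lg = lp_tail q (accumulated_energy q g) N + 1 / 2 * lp_tail q (level_sup_tail g) N"
    have nn: "0 \<le> Lf" "0 \<le> Lg" by (simp_all add: Lf_def Lg_def)
    have "\<bar>fs_integral_between f g s t - f \<xi> * (g t - g s)\<bar> \<le> 8 * Lf * Lg"
      unfolding fs_integral_between_def Lf_def Lg_def using st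
      by (intro energy_Young_Loeve[OF p(1) q(1) pq] f_sum g_sum fg(2)
          hoelder_continuous_on[OF assms(6,1)] hoelder_continuous_on[OF assms(7,3)]) auto
    then have "ennreal \<bar>fs_integral_between f g s t - f \<xi> * (g t - g s)\<bar> \<le> ennreal (8 * Lf * Lg)"
      by (rule ennreal_leI)
    also have "\<dots> = 8 * ennreal Lf * ennreal Lg"
      using nn by (simp add: ennreal_mult)
    finally show ?thesis
      unfolding local_energy_eq[OF f_sum] local_energy_eq[OF g_sum] Lf_def Lg_def .
  qed
  ultimately show ?thesis
    using p q pq fg(1,3) gf(1,3) hoelder_in_energy_space[OF assms(6) p]
      hoelder_in_energy_space[OF assms(7) q] by blast
qed

end
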